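(* Let $(G,\mathcal{B},\mathcal{O})$ be a topological graph and let $T:(G,\mathcal{B},\mathcal{O})\to(G,\mathcal{B},\mathcal{O})$ be a graph homeomorphism with nonzero Lefschetz number, $L(T)\neq 0$. Then $T$ has a fixed subgraph which is a union of elements of $\mathcal{B}$ that all mutually intersect; that is, there is a nonempty set $\mathcal{S}\subset\mathcal{B}$ such that $A\cap B\neq\emptyset$ for all $A,B\in\mathcal{S}$ and such that the subgraph $U=\bigcup_{A\in\mathcal{S}}A$ is fixed by $T$, i.e. $\bigcup_{A\in\mathcal{S}}T(A)=U$.
   Context: All graphs are finite and simple. For a vertex $x$ of a graph $G=(V,E)$, the unit sphere $S(x)$ is the subgraph of $G$ generated (induced) by all vertices adjacent to $x$. The intersection of two subgraphs is the subgraph formed by their common vertices and common edges; a subgraph is also regarded as the set of its vertices when speaking of topologies on $V$. Dimension: $\dim(\emptyset)=-1$ and inductively $\dim(G)=\frac{1}{|V|}\sum_{x\in V}(1+\dim(S(x)))$. Homotopy: the one-point graph $K_1$ is contractible. A homotopy extension of a graph selects a contractible (induced) subgraph $H$ and adds a new vertex $z$ connected exactly to all vertices of $H$ (so $S(z)=H$). The reverse step removes a vertex $z$ with contractible unit sphere $S(z)$, together with all edges at $z$. Two graphs are homotopic if one can be obtained from the other by a finite sequence of such steps; a graph is contractible if it is homotopic to $K_1$. (This is an inductive definition.) Graph topology: two subgraphs $A,B$ satisfy the dimension assumption if $\dim(A\cap B)\ge \min(\dim(A),\dim(B))$, where the dimensions are those of these subgraphs as graphs themselves. A topology $\mathcal{O}$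 on $V$ is a graph topology on $G=(V,E)$ if it has a sub-base $\mathcal{B}$ consisting of contractible subgraphs of $G$ such that (i) the intersection of any two elements of $\mathcal{B}$ satisfying the dimension assumption is contractible; (ii) every edge of $G$ is contained in some $B\in\mathcal{B}$; (iii) the nerve graph $\mathcal{G}=(\mathcal{B},\mathcal{E})$, whose vertices are the elements of $\mathcal{B}$ and whose edges are the pairs of distinct $A,B\in\mathcal{B}$ satisfying the dimension assumption, is homotopic to $G$. A graph with such a topology, written $(G,\mathcal{B},\mathcal{O})$, is a topological graph. Homeomorphism: given topological graphs $(G,\mathcal{B},\mathcal{O})$ and $(H,\mathcal{C},\mathcal{P})$ with nerve graphs $\mathcal{G},\mathcal{H}$, a map $\phi:\mathcal{O}\to\mathcal{P}$ is continuous if it induces a graph homomorphism $\mathcal{G}\to\mathcal{H}$ (it maps each $A\in\mathcal{B}$ to an element $\phi(A)\in\mathcal{C}$, edges of the nerve going to edges) such that $\dim(\phi(A))\le\dim(A)$ for every $A\in\mathcal{B}$. If $\phi$ has an inverse which is also continuous, $\phi$ is a graph homeomorphism. In particular a graph homeomorphism $T$ of $(G,\mathcal{B},\mathcal{O})$ to itself defines an automorphism $A\mapsto T(A)$ of the nerve graph $\mathcal{G}$. Graph cohomology: for a graph $K$, let $\Omega_k$ be the real vector space of alternating functions $f(x_0,\dots,x_k)$ on ordered $(k+1)$-cliques of $K$ (i.e. $f$ changes by the sign of the permutation when the vertices are permuted). The exterior derivative $d_k:\Omega_k\to\Omega_{k+1}$ is $d_kf(x_0,\dots,x_{k+1})=\sum_{j=0}^{k+1}(-1)^j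 f(x_0,\dots,\hat{x}_j,\dots,x_{k+1})$, and $H^k(K)=\ker(d_k)/\operatorname{im}(d_{k-1})$ (with $d_{-1}=0$). Lefschetz number: the automorphism of the nerve graph $\mathcal{G}$ defined by $T$ induces linear maps $T_k$ on the finite-dimensional cohomology groups $H^k(G)$, where $H^k(G)$ is identified with $H^k(\mathcal{G})$ ($G$ and $\mathcal{G}$ being homotopic, these are isomorphic). The Lefschetz number is $L(T)=\sum_{k=0}^{\infty}(-1)^k\operatorname{tr}(T_k)$. *)

theory Defs
  imports
    "HOL-Analysis.Abstract_Topology"
    "HOL-Combinatorics.Permutations"
    "HOL-Algebra.Module"
    "HOL-Algebra.AbelCoset"
begin

section \<open>Finite simple graphs\<close>

datatype 'a graph = Graph (verts: "'a set") (edges: "'a set set")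

definition simple_graph :: "'a graph \<Rightarrow> bool" where
  "simple_graph G \<longleftrightarrow> finite (verts G) \<and> (\<forall>e\<in>edges G. e \<subseteq> verts G \<and> card e = 2)"

definition is_subgraph :: "'a graph \<Rightarrow> 'a graph \<Rightarrow> bool" where
  "is_subgraph A G \<longleftrightarrow> simple_graph A \<and> verts A \<subseteq> verts G \<and> edges A \<subseteq> edges G"

definition induced_subgraph :: "'a graph \<Rightarrow> 'a set \<Rightarrow> 'a graph" where
  "induced_subgraph G S = Graph (verts G \<inter> S) {e \<in> edges G. e \<subseteq> S}"

definition sphere :: "'a graph \<Rightarrow> 'a \<Rightarrow> 'a graph" where
  "sphere G x = induced_subgraph G {y. {x, y} \<in> edges G}"

definition graph_inter :: "'a graph \<Rightarrow> 'a graph \<Rightarrow> 'a graph" where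
  "graph_inter A B = Graph (verts A \<inter> verts B) (edges A \<inter> edges B)"

definition graph_Union :: "'a graph set \<Rightarrow> 'a graph" where
  "graph_Union S = Graph (\<Union>A\<in>S. verts A) (\<Union>A\<in>S. edges A)"

definition graph_hom :: "'a graph \<Rightarrow> 'b graph \<Rightarrow> ('a \<Rightarrow> 'b) \<Rightarrow> bool" where
  "graph_hom G H f \<longleftrightarrow> f ` verts G \<subseteq> verts H \<and> (\<forall>e\<in>edges G. f ` e \<in> edges H)"

definition graph_isomorphic :: "'a graph \<Rightarrow> 'b graph \<Rightarrow> bool" where
  "graph_isomorphic G H \<longleftrightarrow>
     (\<exists>f. bij_betw f (verts G) (verts H) \<and> edges H = (\<lambda>e. f ` e) ` edges G)"


section \<open>Dimension\<close>

lemma card_sphere_less: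
  assumes "simple_graph G" "x \<in> verts G"
  shows "card (verts (sphere G x)) < card (verts G)"
proof (rule psubset_card_mono)
  show "finite (verts G)" using assms by (simp add: simple_graph_def)
  have "{x, x} \<notin> edges G" using assms(1) by (force simp: simple_graph_def)
  then have "x \<notin> verts (sphere G x)" by (simp add: sphere_def induced_subgraph_def)
  moreover have "verts (sphere G x) \<subseteq> verts G"
    by (simp add: sphere_def induced_subgraph_def)
  ultimately show "verts (sphere G x) \<subset> verts G" using assms(2) by blast
qed

text \<open>The guard \<open>\<not> simple_graph G\<close> only serves termination; the value there is irrelevant.\<close>

function graph_dim :: "'a graph \<Rightarrow> real" where
  "graph_dim G =
     (if verts G = {} \<or> \<not> simple_graph G then -1
      else (\<Sum>x\<in>verts G. 1 + graph_dim (sphere G x)) / real (card (verts G)))"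
  by pat_completeness auto
termination
  by (relation "measure (\<lambda>G. card (verts G))") (auto intro: card_sphere_less)

declare graph_dim.simps [simp del]

definition dimension_assumption :: "'a graph \<Rightarrow> 'a graph \<Rightarrow> bool" where
  "dimension_assumption A B \<longleftrightarrow>
     graph_dim (graph_inter A B) \<ge> min (graph_dim A) (graph_dim B)"


section \<open>Homotopy\<close>

definition add_vertex :: "'a graph \<Rightarrow> 'a set \<Rightarrow> 'a \<Rightarrow> 'a graph" where
  "add_vertex G S z = Graph (insert z (verts G)) (edges G \<union> {{z, y} | y. y \<in> S})"

definition remove_vertex :: "'a graph \<Rightarrow> 'a \<Rightarrow> 'a graph" where
  "remove_vertex G z = induced_subgraph G (verts G - {z})"

text \<open>
  A homotopy extension needs new vertices, so over a finite type of vertices the generating steps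
  would be artificially limited. The relation is therefore generated on graphs with vertices in
  \<open>nat\<close>, and then transported to arbitrary vertex types along graph isomorphisms. This also
  makes it possible to compare graphs with different vertex types, such as a graph and its nerve.
\<close>

inductive contractible_nat :: "nat graph \<Rightarrow> bool"
  and homotopic_nat :: "nat graph \<Rightarrow> nat graph \<Rightarrow> bool" where
  contractible: "homotopic_nat G (Graph {x} {}) \<Longrightarrow> contractible_nat G"
| refl: "simple_graph G \<Longrightarrow> homotopic_nat G G"
| extend: "\<lbrakk>homotopic_nat G H; S \<subseteq> verts H; contractible_nat (induced_subgraph H S); z \<notin> verts H\<rbrakk>
    \<Longrightarrow> homotopic_nat G (add_vertex H S z)"
| reduce: "\<lbrakk>homotopic_nat G H; z \<in> verts H; contractible_nat (sphere H z)\<rbrakk>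
    \<Longrightarrow> homotopic_nat G (remove_vertex H z)"

definition contractible_graph :: "'a graph \<Rightarrow> bool" where
  "contractible_graph G \<longleftrightarrow> (\<exists>G'. graph_isomorphic G G' \<and> contractible_nat G')"

definition homotopic_graphs :: "'a graph \<Rightarrow> 'b graph \<Rightarrow> bool" where
  "homotopic_graphs G H \<longleftrightarrow>
     (\<exists>G' H'. graph_isomorphic G G' \<and> graph_isomorphic H H' \<and> homotopic_nat G' H')"


section \<open>Topological graphs\<close>

definition nerve :: "'a graph set \<Rightarrow> 'a graph graph" where
  "nerve \<B> = Graph \<B> {{A, B} | A B. A \<in> \<B> \<and> B \<in> \<B> \<and> A \<noteq> B \<and> dimension_assumption A B}"

text \<open>
  The vertex sets of the members of \<open>\<B>\<close> form a sub-base of the topology \<open>X\<close> on the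
  vertex set of \<open>G\<close>; as usual the empty intersection is the whole vertex set.
\<close>

definition is_subbase :: "'a graph \<Rightarrow> 'a graph set \<Rightarrow> 'a topology \<Rightarrow> bool" where
  "is_subbase G \<B> X \<longleftrightarrow>
     X = topology (arbitrary union_of
           (finite intersection_of (\<lambda>U. U \<in> verts ` \<B>) relative_to verts G))"

definition topological_graph :: "'a graph \<Rightarrow> 'a graph set \<Rightarrow> 'a topology \<Rightarrow> bool" where
  "topological_graph G \<B> X \<longleftrightarrow>
     simple_graph G \<and>
     (\<forall>A\<in>\<B>. is_subgraph A G \<and> contractible_graph A) \<and>
     is_subbase G \<B> X \<and>
     (\<forall>A\<in>\<B>. \<forall>B\<in>\<B>. dimension_assumption A B \<longrightarrow> contractible_graph (graph_inter A B)) \<and>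
     (\<forall>e\<in>edges G. \<exists>B\<in>\<B>. e \<in> edges B) \<and>
     homotopic_graphs (nerve \<B>) G"

text \<open>
  A map of topological graphs consists of its action \<open>\<phi>\<close> on open sets and of the map \<open>\<tau>\<close> which
  it induces on the members of the sub-base. Both are recorded since a member of the sub-base is a
  graph, which (not being necessarily an induced subgraph) need not be determined by its vertex
  set. If distinct members have distinct vertex sets, \<open>\<tau>\<close> is determined by \<open>\<phi>\<close>.
\<close>

definition graph_continuous ::
  "'a graph set \<Rightarrow> 'a topology \<Rightarrow> 'b graph set \<Rightarrow> 'b topology \<Rightarrow>
   ('a set \<Rightarrow> 'b set) \<Rightarrow> ('a graph \<Rightarrow> 'b graph) \<Rightarrow> bool" where
  "graph_continuous \<B> X \<C> Y \<phi> \<tau> \<longleftrightarrow>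
     (\<forall>U. openin X U \<longrightarrow> openin Y (\<phi> U)) \<and>
     (\<forall>A\<in>\<B>. verts (\<tau> A) = \<phi> (verts A)) \<and>
     graph_hom (nerve \<B>) (nerve \<C>) \<tau> \<and>
     (\<forall>A\<in>\<B>. graph_dim (\<tau> A) \<le> graph_dim A)"

definition graph_homeomorphism ::
  "'a graph set \<Rightarrow> 'a topology \<Rightarrow> 'b graph set \<Rightarrow> 'b topology \<Rightarrow>
   ('a set \<Rightarrow> 'b set) \<Rightarrow> ('a graph \<Rightarrow> 'b graph) \<Rightarrow> bool" where
  "graph_homeomorphism \<B> X \<C> Y \<phi> \<tau> \<longleftrightarrow>
     graph_continuous \<B> X \<C> Y \<phi> \<tau> \<and>
     (\<exists>\<psi> \<sigma>. graph_continuous \<C> Y \<B> X \<psi> \<sigma> \<and>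
        (\<forall>U. openin X U \<longrightarrow> \<psi> (\<phi> U) = U) \<and> (\<forall>W. openin Y W \<longrightarrow> \<phi> (\<psi> W) = W) \<and>
        (\<forall>A\<in>\<B>. \<sigma> (\<tau> A) = A) \<and> (\<forall>C\<in>\<C>. \<tau> (\<sigma> C) = C))"


section \<open>Traces and quotients of real vector spaces\<close>

text \<open>
  Real vector spaces are records of type \<^typ>\<open>(real, 'v) module\<close>. The ring fields \<open>mult\<close> and
  \<open>one\<close> of such a record carry no information and are left undefined.
\<close>

definition lin_comb :: "(real, 'v) module \<Rightarrow> 'v list \<Rightarrow> (nat \<Rightarrow> real) \<Rightarrow> 'v" where
  "lin_comb M bs c = (\<Oplus>\<^bsub>M\<^esub>i\<in>{..<length bs}. c i \<odot>\<^bsub>M\<^esub> (bs ! i))"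

definition is_basis :: "(real, 'v) module \<Rightarrow> 'v list \<Rightarrow> bool" where
  "is_basis M bs \<longleftrightarrow> set bs \<subseteq> carrier M \<and>
     (\<forall>v\<in>carrier M. \<exists>!c. c \<in> extensional {..<length bs} \<and> v = lin_comb M bs c)"

definition coords :: "(real, 'v) module \<Rightarrow> 'v list \<Rightarrow> 'v \<Rightarrow> nat \<Rightarrow> real" where
  "coords M bs v = (THE c. c \<in> extensional {..<length bs} \<and> v = lin_comb M bs c)"

text \<open>The sum of the diagonal entries of the matrix of \<open>T\<close> in some basis (the value does not
  depend on the basis).\<close>

definition trace_on :: "(real, 'v) module \<Rightarrow> ('v \<Rightarrow> 'v) \<Rightarrow> real" where
  "trace_on M T = (let bs = (SOME bs. is_basis M bs)
                   in \<Sum>i<length bs. coords M bs (T (bs ! i)) i)"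

definition quotient_space :: "(real, 'v) module \<Rightarrow> 'v set \<Rightarrow> (real, 'v set) module" where
  "quotient_space M N =
     \<lparr>carrier = a_rcosets\<^bsub>M\<^esub> N, mult = undefined, one = undefined, zero = N,
      add = set_add M, smult = (\<lambda>c X. \<Union>x\<in>X. N +>\<^bsub>M\<^esub> (c \<odot>\<^bsub>M\<^esub> x))\<rparr>"

definition quotient_map :: "(real, 'v) module \<Rightarrow> 'v set \<Rightarrow> ('v \<Rightarrow> 'v) \<Rightarrow> 'v set \<Rightarrow> 'v set" where
  "quotient_map M N T X = (\<Union>x\<in>X. N +>\<^bsub>M\<^esub> T x)"


section \<open>Graph cohomology\<close>

definition ordered_cliques :: "'v graph \<Rightarrow> nat \<Rightarrow> 'v list set" where
  "ordered_cliques K n = {xs. length xs = n \<and> distinct xs \<and> set xs \<subseteq> verts K \<and>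
     (\<forall>x\<in>set xs. \<forall>y\<in>set xs. x \<noteq> y \<longrightarrow> {x, y} \<in> edges K)}"

text \<open>Functions on ordered \<open>(k+1)\<close>-cliques are represented as functions on lists which vanish on
  all other lists.\<close>

definition cochains :: "'v graph \<Rightarrow> nat \<Rightarrow> (real, 'v list \<Rightarrow> real) module" where
  "cochains K k =
     \<lparr>carrier = {f. (\<forall>xs. xs \<notin> ordered_cliques K (Suc k) \<longrightarrow> f xs = 0) \<and>
        (\<forall>xs\<in>ordered_cliques K (Suc k). \<forall>p. p permutes {..<Suc k} \<longrightarrow>
           f (permute_list p xs) = of_int (sign p) * f xs)},
      mult = undefined, one = undefined, zero = (\<lambda>xs. 0),
      add = (\<lambda>f g xs. f xs + g xs), smult = (\<lambda>c f xs. c * f xs)\<rparr>"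

definition ext_deriv :: "'v graph \<Rightarrow> nat \<Rightarrow> ('v list \<Rightarrow> real) \<Rightarrow> 'v list \<Rightarrow> real" where
  "ext_deriv K k f xs =
     (if xs \<in> ordered_cliques K (Suc (Suc k))
      then \<Sum>j\<le>Suc k. (-1) ^ j * f (take j xs @ drop (Suc j) xs) else 0)"

definition cocycles :: "'v graph \<Rightarrow> nat \<Rightarrow> ('v list \<Rightarrow> real) set" where
  "cocycles K k = a_kernel (cochains K k) (cochains K (Suc k)) (ext_deriv K k)"

fun coboundaries :: "'v graph \<Rightarrow> nat \<Rightarrow> ('v list \<Rightarrow> real) set" where
  "coboundaries K 0 = {\<zero>\<^bsub>cochains K 0\<^esub>}"
| "coboundaries K (Suc k) = ext_deriv K k ` carrier (cochains K k)"

definition cocycle_space :: "'v graph \<Rightarrow> nat \<Rightarrow> (real, 'v list \<Rightarrow> real) module" where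
  "cocycle_space K k = (cochains K k)\<lparr>carrier := cocycles K k\<rparr>"

definition cohomology :: "'v graph \<Rightarrow> nat \<Rightarrow> (real, ('v list \<Rightarrow> real) set) module" where
  "cohomology K k = quotient_space (cocycle_space K k) (coboundaries K k)"

definition pullback :: "'v graph \<Rightarrow> nat \<Rightarrow> ('v \<Rightarrow> 'v) \<Rightarrow> ('v list \<Rightarrow> real) \<Rightarrow> 'v list \<Rightarrow> real" where
  "pullback K k T f xs = (if xs \<in> ordered_cliques K (Suc k) then f (map T xs) else 0)"

definition cohomology_map ::
  "'v graph \<Rightarrow> nat \<Rightarrow> ('v \<Rightarrow> 'v) \<Rightarrow> ('v list \<Rightarrow> real) set \<Rightarrow> ('v list \<Rightarrow> real) set" where
  "cohomology_map K k T = quotient_map (cocycle_space K k) (coboundaries K k) (pullback K k T)"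

text \<open>Only finitely many terms of the series are nonzero when the graph is finite.\<close>

definition lefschetz_number :: "'v graph \<Rightarrow> ('v \<Rightarrow> 'v) \<Rightarrow> real" where
  "lefschetz_number K T = (\<Sum>k. (-1) ^ k * trace_on (cohomology K k) (cohomology_map K k T))"

end

theory Submission
  imports Defs "HOL-Library.Function_Algebras"
begin

text \<open>
  The theorem is the Hopf trace formula on the nerve. Decomposing the cochain spaces \<open>C\<close> as
  \<open>C / Z\<close>, \<open>Z / B\<close>, \<open>B\<close>, where \<open>d\<close> identifies \<open>C / Z\<close> with the next space of coboundaries, turns the
  Lefschetz number into the alternating sum of the traces on the cochains. If no clique of the
  nerve is mapped onto itself, then all these traces vanish. So a nonzero Lefschetz number gives a
  clique \<open>S\<close> with \<open>T ` S = S\<close>. Any two members of \<open>S\<close> have a contractible intersection, and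
  contractible graphs are nonempty because homotopy steps never create or destroy the empty graph.
\<close>

section \<open>Traces modulo a subspace\<close>

text \<open>One obstacle is the form of the traces: \<open>trace_on\<close> refers to a chosen basis
  of a record whose elements are cosets. The linear algebra is therefore done for maps on a
  subquotient Z / N of one fixed vector space, with a basis of the quotient stored as a list of
  representatives in Z. Kernels, images and nested subspaces then all live in the same ambient
  space, and cosets appear only when \<open>trace_on\<close> is translated. The traces on cochains
  raise a second problem: alternating functions have no distinguished basis unless an orientation is
  chosen for every clique. Antisymmetrization avoids this choice. It lets the trace be taken on all
  functions on ordered cliques, where the point masses form a basis and diagonal entries can be read
  off. Finally, the Lefschetz number is an infinite series, so the coboundary traces cancel in a
  telescoping series. Its two ends vanish because the coboundaries are zero in degree 0 and in
  degrees above the number of vertices.\<close>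

locale linear_trace = vector_space scale
  for scale :: "'a::field \<Rightarrow> 'b::ab_group_add \<Rightarrow> 'b" (infixr "*s" 75)
begin

definition comb :: "'b list \<Rightarrow> (nat \<Rightarrow> 'a) \<Rightarrow> 'b" where
  "comb rs c = (\<Sum>i<length rs. c i *s rs ! i)"

text \<open>The list \<open>rs\<close> represents a basis of the quotient of \<open>Z\<close> by \<open>N\<close>.\<close>

definition basis_mod :: "'b set \<Rightarrow> 'b set \<Rightarrow> 'b list \<Rightarrow> bool" where
  "basis_mod Z N rs \<longleftrightarrow> set rs \<subseteq> Z \<and> (\<forall>v\<in>Z. \<exists>c. v - comb rs c \<in> N) \<and>
     (\<forall>c. comb rs c \<in> N \<longrightarrow> (\<forall>i<length rs. c i = 0))"

text \<open>Independence modulo N determines the choice only at positions of the list; beyond them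
  the value is arbitrary, so facts about single coordinates carry
  \<open>i < length rs\<close>.\<close>

definition coord_mod :: "'b set \<Rightarrow> 'b list \<Rightarrow> 'b \<Rightarrow> nat \<Rightarrow> 'a" where
  "coord_mod N rs v = (SOME c. v - comb rs c \<in> N)"

definition trace_wrt :: "'b set \<Rightarrow> 'b list \<Rightarrow> ('b \<Rightarrow> 'b) \<Rightarrow> 'a" where
  "trace_wrt N rs T = (\<Sum>i<length rs. coord_mod N rs (T (rs ! i)) i)"

definition trace_mod :: "'b set \<Rightarrow> 'b set \<Rightarrow> ('b \<Rightarrow> 'b) \<Rightarrow> 'a" where
  "trace_mod Z N T = trace_wrt N (SOME rs. basis_mod Z N rs) T"

section \<open>Coordinates modulo a subspace and independence of the basis\<close>

lemma comb_diff: "comb rs c - comb rs c' = comb rs (\<lambda>i. c i - c' i)"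
  by (simp add: comb_def sum_subtractf scale_left_diff_distrib)

lemma comb_cong: "(\<And>i. i < length rs \<Longrightarrow> c i = c' i) \<Longrightarrow> comb rs c = comb rs c'"
  by (simp add: comb_def)

lemma comb_append: "comb (xs @ ys) c = comb xs c + comb ys (\<lambda>i. c (length xs + i))"
proof -
  have "comb (xs @ ys) c = (\<Sum>i\<in>{..<length xs}. c i *s (xs @ ys) ! i) +
      (\<Sum>i\<in>{length xs..<length xs + length ys}. c i *s (xs @ ys) ! i)"
    unfolding comb_def length_append
    by (subst sum.union_disjoint [symmetric]) (auto intro!: sum.cong)
  also have "(\<Sum>i\<in>{length xs..<length xs + length ys}. c i *s (xs @ ys) ! i) =
      comb ys (\<lambda>i. c (length xs + i))"
    unfolding comb_def
    by (rule sum.reindex_bij_witness [of _ "\<lambda>i. length xs + i" "\<lambda>i. i - length xs"])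
      (auto simp: nth_append)
  finally show ?thesis by (simp add: comb_def nth_append)
qed

lemma comb_in_subspace: "subspace Z \<Longrightarrow> set rs \<subseteq> Z \<Longrightarrow> comb rs c \<in> Z"
  unfolding comb_def by (intro subspace_sum subspace_scale) auto

lemma comb_hom:
  assumes "module_hom scale scale T"
  shows "T (comb rs c) = comb (map T rs) c"
proof -
  interpret T: module_hom scale scale T by fact
  show ?thesis by (simp add: comb_def T.sum T.scale)
qed

lemma coord_mod_eq:
  assumes "subspace N" "basis_mod Z N rs" "v - comb rs c \<in> N" "i < length rs"
  shows "coord_mod N rs v i = c i"
proof -
  have "v - comb rs (coord_mod N rs v) \<in> N"
    unfolding coord_mod_def by (rule someI [where P = "\<lambda>c. v - comb rs c \<in> N"]) (rule assms(3))
  from subspace_diff [OF assms(1) this assms(3)]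
  have "comb rs c - comb rs (coord_mod N rs v) \<in> N" by (simp add: algebra_simps)
  then show ?thesis using assms(2,4) unfolding basis_mod_def comb_diff by fastforce
qed

lemma coord_mod:
  assumes "basis_mod Z N rs" "v \<in> Z"
  shows "v - comb rs (coord_mod N rs v) \<in> N"
  unfolding coord_mod_def using assms by (metis basis_mod_def someI)

text \<open>The rule for matrix products. \<open>vs\<close> is only required to lie in Z, because it
  is used both for a second basis and for the images of a basis under a map.\<close>

lemma coord_mod_comb:
  assumes N: "subspace N" and b: "basis_mod Z N rs" and vs: "set vs \<subseteq> Z"
    and w: "w - comb vs c \<in> N" and i: "i < length rs"
  shows "coord_mod N rs w i = (\<Sum>j<length vs. c j * coord_mod N rs (vs ! j) i)"
proof (rule coord_mod_eq [OF N b _ i])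
  let ?a = "\<lambda>j. coord_mod N rs (vs ! j)"
  have "comb rs (\<lambda>i. \<Sum>j<length vs. c j * ?a j i) = (\<Sum>j<length vs. c j *s comb rs (?a j))"
    unfolding comb_def scale_sum_left scale_sum_right by (subst sum.swap) simp
  then have "comb vs c - comb rs (\<lambda>i. \<Sum>j<length vs. c j * ?a j i) =
      (\<Sum>j<length vs. c j *s (vs ! j - comb rs (?a j)))"
    unfolding comb_def [of vs] by (simp add: sum_subtractf scale_right_diff_distrib)
  also have "\<dots> \<in> N"
  proof (intro subspace_sum [OF N] subspace_scale [OF N] coord_mod [OF b])
    fix j assume "j \<in> {..<length vs}"
    then show "vs ! j \<in> Z" using vs nth_mem by fastforce
  qed
  finally have "comb vs c - comb rs (\<lambda>i. \<Sum>j<length vs. c j * ?a j i) \<in> N" .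
  from subspace_add [OF N w this]
  show "w - comb rs (\<lambda>i. \<Sum>j<length vs. c j * ?a j i) \<in> N" by (simp add: algebra_simps)
qed

text \<open>This is \<open>tr (P Q) = tr (Q P)\<close> for the change of basis matrix \<open>Q\<close>.\<close>

lemma trace_wrt_unique:
  assumes N: "subspace N" and b: "basis_mod Z N rs" and b': "basis_mod Z N rs'"
    and T: "module_hom scale scale T" and TZ: "T ` Z \<subseteq> Z" and TN: "T ` N \<subseteq> N"
  shows "trace_wrt N rs T = trace_wrt N rs' T"
proof -
  interpret T: module_hom scale scale T by fact
  have rs: "set rs \<subseteq> Z" "set rs' \<subseteq> Z" using b b' by (simp_all add: basis_mod_def)
  have mem: "rs ! i \<in> Z" if "i < length rs" for i using rs(1) that by auto
  have mem': "rs' ! i \<in> Z" if "i < length rs'" for i using rs(2) that by auto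
  \<comment> \<open>P has the entries \<open>coord_mod N rs' (T (rs ! i)) j\<close> and describes T
    from \<open>rs\<close> to \<open>rs'\<close>; Q has the entries
    \<open>coord_mod N rs (rs' ! j) i\<close>. Both traces are sums of products of these
    entries.\<close>
  have "trace_wrt N rs T = (\<Sum>i<length rs. \<Sum>j<length rs'.
      coord_mod N rs' (T (rs ! i)) j * coord_mod N rs (rs' ! j) i)"
    unfolding trace_wrt_def
  proof (intro sum.cong HOL.refl)
    fix i assume i: "i \<in> {..<length rs}"
    have "T (rs ! i) - comb rs' (coord_mod N rs' (T (rs ! i))) \<in> N"
      using coord_mod [OF b'] TZ mem i by auto
    then show "coord_mod N rs (T (rs ! i)) i =
        (\<Sum>j<length rs'. coord_mod N rs' (T (rs ! i)) j * coord_mod N rs (rs' ! j) i)"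
      using coord_mod_comb [OF N b rs(2)] i by blast
  qed
  also have "\<dots> = (\<Sum>j<length rs'. \<Sum>i<length rs.
      coord_mod N rs (rs' ! j) i * coord_mod N rs' (T (rs ! i)) j)"
    by (subst sum.swap) (simp add: mult.commute)
  also have "\<dots> = trace_wrt N rs' T"
    unfolding trace_wrt_def
  proof (intro sum.cong HOL.refl)
    fix j assume j: "j \<in> {..<length rs'}"
    have "rs' ! j - comb rs (coord_mod N rs (rs' ! j)) \<in> N"
      using coord_mod [OF b] mem' j by auto
    \<comment> \<open>Invariance of N lets T be applied to a congruence modulo N.\<close>
    then have "T (rs' ! j - comb rs (coord_mod N rs (rs' ! j))) \<in> N" using TN by blast
    then have "T (rs' ! j) - comb (map T rs) (coord_mod N rs (rs' ! j)) \<in> N"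
      by (simp add: T.diff comb_hom [OF T])
    moreover have "set (map T rs) \<subseteq> Z" using TZ rs by auto
    ultimately have "coord_mod N rs' (T (rs' ! j)) j =
        (\<Sum>i<length (map T rs). coord_mod N rs (rs' ! j) i * coord_mod N rs' (map T rs ! i) j)"
      using coord_mod_comb [OF N b'] j by blast
    then show "(\<Sum>i<length rs. coord_mod N rs (rs' ! j) i * coord_mod N rs' (T (rs ! i)) j) =
        coord_mod N rs' (T (rs' ! j)) j" by simp
  qed
  finally show ?thesis .
qed

lemma trace_mod_eq:
  assumes "subspace N" and b: "basis_mod Z N rs"
    and "module_hom scale scale T" "T ` Z \<subseteq> Z" "T ` N \<subseteq> N"
  shows "trace_mod Z N T = trace_wrt N rs T"
  unfolding trace_mod_def
  by (rule trace_wrt_unique [OF assms(1) _ b assms(3-5)]) (rule someI [where P = "basis_mod Z N", OF b])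

section \<open>Additivity of the trace along nested subspaces\<close>

lemma basis_mod_append:
  assumes N: "subspace N" and M: "subspace M" and Z: "subspace Z" and NM: "N \<subseteq> M" and MZ: "M \<subseteq> Z"
    and b: "basis_mod Z M rs" and b': "basis_mod M N ns"
  shows "basis_mod Z N (ns @ rs)"
  unfolding basis_mod_def
proof (intro conjI ballI allI impI)
  show "set (ns @ rs) \<subseteq> Z" using b b' MZ by (auto simp: basis_mod_def)
next
  fix v assume "v \<in> Z"
  then obtain c where "v - comb rs c \<in> M" using b by (auto simp: basis_mod_def)
  then obtain c' where c': "v - comb rs c - comb ns c' \<in> N" using b' by (auto simp: basis_mod_def)
  let ?c = "\<lambda>i. if i < length ns then c' i else c (i - length ns)"
  have "comb (ns @ rs) ?c = comb ns c' + comb rs c"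
    unfolding comb_append by (intro arg_cong2 [of _ _ _ _ "(+)"] comb_cong) auto
  then have "v - comb (ns @ rs) ?c \<in> N" using c' by (simp add: algebra_simps)
  then show "\<exists>c. v - comb (ns @ rs) c \<in> N" by blast
next
  fix c i assume c: "comb (ns @ rs) c \<in> N" and i: "i < length (ns @ rs)"
  have ns: "comb ns c' \<in> M" for c'
    using comb_in_subspace [OF M] b' by (auto simp: basis_mod_def)
  have eq: "comb (ns @ rs) c = comb ns c + comb rs (\<lambda>i. c (length ns + i))" by (rule comb_append)
  \<comment> \<open>Modulo M the part over \<open>ns\<close> disappears, so the coefficients of
    \<open>rs\<close> vanish first; what remains is a relation over \<open>ns\<close> modulo
    N.\<close>
  have "comb rs (\<lambda>i. c (length ns + i)) \<in> M"
    using subspace_diff [OF M subsetD [OF NM c] ns [of c]] eq by simp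
  then have 0: "c (length ns + i) = 0" if "i < length rs" for i
    using b that unfolding basis_mod_def by auto
  then have "comb rs (\<lambda>i. c (length ns + i)) = 0" by (simp add: comb_def)
  then have "comb ns c \<in> N" using c eq by simp
  then have "c i = 0" if "i < length ns" for i using b' that unfolding basis_mod_def by auto
  with 0 [of "i - length ns"] i show "c i = 0" by (cases "i < length ns") auto
qed

text \<open>T preserves M, so its matrix in the combined basis is block triangular, with diagonal
  blocks belonging to M / N and Z / M.\<close>

lemma trace_wrt_append:
  assumes N: "subspace N" and M: "subspace M" and Z: "subspace Z" and NM: "N \<subseteq> M" and MZ: "M \<subseteq> Z"
    and b: "basis_mod Z M rs" and b': "basis_mod M N ns"
    and TZ: "T ` Z \<subseteq> Z" and TM: "T ` M \<subseteq> M"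
  shows "trace_wrt N (ns @ rs) T = trace_wrt N ns T + trace_wrt M rs T"
proof -
  have B: "basis_mod Z N (ns @ rs)" by (rule basis_mod_append) fact+
  have 1: "coord_mod N (ns @ rs) (T (ns ! i)) i = coord_mod N ns (T (ns ! i)) i"
    if i: "i < length ns" for i
  proof -
    \<comment> \<open>The zeros in \<open>?c\<close> are the vanishing block: the images of
      \<open>ns\<close> stay in M and have no component along \<open>rs\<close>.\<close>
    let ?v = "T (ns ! i)" let ?c = "\<lambda>j. if j < length ns then coord_mod N ns ?v j else 0"
    have "ns ! i \<in> M" using b' i by (auto simp: basis_mod_def)
    then have "?v - comb ns (coord_mod N ns ?v) \<in> N" using coord_mod [OF b'] TM by blast
    moreover have "comb ns ?c = comb ns (coord_mod N ns ?v)" by (rule comb_cong) simp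
    moreover have "comb rs (\<lambda>j. ?c (length ns + j)) = 0" by (simp add: comb_def)
    ultimately have "?v - comb (ns @ rs) ?c \<in> N" by (simp add: comb_append)
    from coord_mod_eq [OF N B this] i show ?thesis by simp
  qed
  have 2: "coord_mod N (ns @ rs) (T (rs ! i)) (length ns + i) = coord_mod M rs (T (rs ! i)) i"
    if i: "i < length rs" for i
  proof -
    let ?v = "T (rs ! i)" let ?c = "coord_mod N (ns @ rs) ?v"
    have "rs ! i \<in> Z" using b i by (auto simp: basis_mod_def)
    then have "?v - comb (ns @ rs) ?c \<in> N" using coord_mod [OF B] TZ by blast
    moreover have "comb ns ?c \<in> M" using comb_in_subspace [OF M] b' by (auto simp: basis_mod_def)
    ultimately have "?v - comb (ns @ rs) ?c + comb ns ?c \<in> M"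
      using subspace_add [OF M] NM by blast
    then have "?v - comb rs (\<lambda>j. ?c (length ns + j)) \<in> M" by (simp add: comb_append)
    from coord_mod_eq [OF M b this i] show ?thesis by simp
  qed
  have "trace_wrt N (ns @ rs) T = (\<Sum>i\<in>{..<length ns}. coord_mod N (ns @ rs) (T ((ns @ rs) ! i)) i) +
      (\<Sum>i\<in>{length ns..<length ns + length rs}. coord_mod N (ns @ rs) (T ((ns @ rs) ! i)) i)"
    unfolding trace_wrt_def length_append
    by (subst sum.union_disjoint [symmetric]) (auto intro!: sum.cong)
  also have "(\<Sum>i\<in>{..<length ns}. coord_mod N (ns @ rs) (T ((ns @ rs) ! i)) i) = trace_wrt N ns T"
    unfolding trace_wrt_def by (intro sum.cong) (auto simp: nth_append 1)
  also have "(\<Sum>i\<in>{length ns..<length ns + length rs}. coord_mod N (ns @ rs) (T ((ns @ rs) ! i)) i) =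
      trace_wrt M rs T"
    unfolding trace_wrt_def
    by (rule sum.reindex_bij_witness [of _ "\<lambda>i. length ns + i" "\<lambda>i. i - length ns"])
      (auto simp: nth_append 2 [symmetric])
  finally show ?thesis .
qed

text \<open>A basis A of N is extended to a basis B of Z, and B - A represents a basis of the
  quotient. The spanning set F, which may lie outside Z, makes B finite.\<close>

lemma basis_mod_exists:
  assumes N: "subspace N" and Z: "subspace Z" and NZ: "N \<subseteq> Z" and F: "finite F" "Z \<subseteq> span F"
  shows "\<exists>rs. basis_mod Z N rs"
proof -
  obtain A where A: "A \<subseteq> N" "independent A" "N \<subseteq> span A"
    by (rule maximal_independent_subset)
  obtain B where B: "A \<subseteq> B" "B \<subseteq> Z" "independent B" "Z \<subseteq> span B"
    using maximal_independent_subset_extend [of A Z] A NZ by blast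
  have "finite B" using independent_span_bound [OF F(1) B(3)] B F by blast
  then obtain rs where rs: "set rs = B - A" "distinct rs"
    using finite_distinct_list [of "B - A"] by blast
  \<comment> \<open>\<open>ix\<close> gives the position of a vector in \<open>rs\<close>. It
    translates the sums over positions in \<open>comb\<close> into the sums over sets used by span
    and independence.\<close>
  define ix where "ix = the_inv_into {..<length rs} ((!) rs)"
  have ix: "ix (rs ! i) = i" if "i < length rs" for i
    unfolding ix_def using that rs(2) by (intro the_inv_into_f_f) (auto simp: inj_on_nth)
  have comb: "comb rs c = (\<Sum>b\<in>B - A. c (ix b) *s b)" for c
  proof -
    have "bij_betw ((!) rs) {..<length rs} (B - A)"
      using rs by (intro bij_betw_nth) simp_all
    then have "(\<Sum>b\<in>B - A. c (ix b) *s b) = (\<Sum>i<length rs. c (ix (rs ! i)) *s rs ! i)"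
      by (rule sum.reindex_bij_betw [symmetric])
    then show ?thesis by (simp add: comb_def ix)
  qed
  have spanA: "span A \<subseteq> N" using A N by (simp add: span_minimal)
  show ?thesis
    unfolding basis_mod_def
  proof (intro exI [of _ rs] conjI ballI allI impI)
    show "set rs \<subseteq> Z" using rs B by auto
  next
    fix v assume "v \<in> Z"
    then obtain u where u: "v = (\<Sum>b\<in>B. u b *s b)"
      using B(4) span_finite [OF \<open>finite B\<close>] by auto
    have "v = (\<Sum>b\<in>B - A. u b *s b) + (\<Sum>b\<in>A. u b *s b)"
      unfolding u by (rule sum.subset_diff) (use B \<open>finite B\<close> in auto)
    moreover have "(\<Sum>b\<in>B - A. u b *s b) = comb rs (\<lambda>i. u (rs ! i))"
      unfolding comb
    proof (intro sum.cong HOL.refl)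
      fix b assume "b \<in> B - A"
      then obtain i where "i < length rs" "b = rs ! i" using rs(1) by (metis in_set_conv_nth)
      then show "u b *s b = u (rs ! ix b) *s b" by (simp add: ix)
    qed
    ultimately have "v - comb rs (\<lambda>i. u (rs ! i)) = (\<Sum>b\<in>A. u b *s b)" by simp
    moreover have "(\<Sum>b\<in>A. u b *s b) \<in> N"
      by (intro subspace_sum [OF N] subspace_scale [OF N]) (use A in auto)
    ultimately show "\<exists>c. v - comb rs c \<in> N" by metis
  next
    fix c i assume c: "comb rs c \<in> N" and i: "i < length rs"
    have "finite A" using \<open>finite B\<close> B finite_subset by blast
    have "comb rs c \<in> span A" using c A by auto
    then obtain u where u: "comb rs c = (\<Sum>b\<in>A. u b *s b)"
      using span_finite [OF \<open>finite A\<close>] by auto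
    \<comment> \<open>Moving the combination over A to the other side gives a linear relation on all
      of B, hence the minus sign on A.\<close>
    let ?w = "\<lambda>b. if b \<in> A then - u b else c (ix b)"
    have "(\<Sum>b\<in>B. ?w b *s b) = (\<Sum>b\<in>B - A. ?w b *s b) + (\<Sum>b\<in>A. ?w b *s b)"
      by (rule sum.subset_diff) (use B \<open>finite B\<close> in auto)
    also have "\<dots> = comb rs c - (\<Sum>b\<in>A. u b *s b)"
      unfolding comb by (simp add: sum_negf)
    finally have "(\<Sum>b\<in>B. ?w b *s b) = 0" using u by simp
    moreover have "rs ! i \<in> B - A" using rs i nth_mem by blast
    ultimately have "?w (rs ! i) = 0"
      using B(3) \<open>finite B\<close> independentD [of B B ?w "rs ! i"] by blast
    then show "c i = 0" using \<open>rs ! i \<in> B - A\<close> i by (simp add: ix)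
  qed
qed

lemma trace_mod_add:
  assumes N: "subspace N" and M: "subspace M" and Z: "subspace Z" and NM: "N \<subseteq> M" and MZ: "M \<subseteq> Z"
    and F: "finite F" "Z \<subseteq> span F"
    and T: "module_hom scale scale T" and TZ: "T ` Z \<subseteq> Z" and TM: "T ` M \<subseteq> M" and TN: "T ` N \<subseteq> N"
  shows "trace_mod Z N T = trace_mod M N T + trace_mod Z M T"
proof -
  obtain rs where rs: "basis_mod Z M rs" using basis_mod_exists [OF M Z MZ F] by blast
  obtain ns where ns: "basis_mod M N ns" using basis_mod_exists [OF N M NM F(1)] MZ F(2) by blast
  have "basis_mod Z N (ns @ rs)" by (rule basis_mod_append) fact+
  from trace_mod_eq [OF N this T TZ TN]
  show ?thesis
    by (simp add: trace_wrt_append [OF N M Z NM MZ rs ns TZ TM]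
        trace_mod_eq [OF N ns T TM TN] trace_mod_eq [OF M rs T TZ TM])
qed

lemma trace_mod_kernel:
  assumes Z: "subspace Z" and F: "finite F" "Z \<subseteq> span F"
    and d: "module_hom scale scale d"
    and T: "module_hom scale scale T" and TZ: "T ` Z \<subseteq> Z"
    and T': "module_hom scale scale T'" and comm: "\<And>v. v \<in> Z \<Longrightarrow> d (T v) = T' (d v)"
  shows "trace_mod Z {v\<in>Z. d v = 0} T = trace_mod (d ` Z) {0} T'"
proof -
  interpret d: module_hom scale scale d by fact
  interpret T: module_hom scale scale T by fact
  interpret T': module_hom scale scale T' by fact
  let ?N = "{v\<in>Z. d v = 0}"
  have N: "subspace ?N"
    unfolding subspace_def using Z
    by (auto simp: d.add d.scale subspace_0 subspace_add subspace_scale)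
  obtain rs where rs: "basis_mod Z ?N rs" using basis_mod_exists [OF N Z _ F] by blast
  have rsZ: "set rs \<subseteq> Z" using rs by (simp add: basis_mod_def)
  have iff: "d v - comb (map d rs) c = 0 \<longleftrightarrow> v - comb rs c \<in> ?N" if "v \<in> Z" for v c
    using comb_in_subspace [OF Z rsZ, of c] that
    by (auto simp: d.diff comb_hom [OF d] subspace_diff [OF Z])
  have iff0: "comb (map d rs) c = 0 \<longleftrightarrow> comb rs c \<in> ?N" for c
    using comb_in_subspace [OF Z rsZ, of c] by (simp add: comb_hom [OF d])
  have B: "basis_mod (d ` Z) {0} (map d rs)"
    unfolding basis_mod_def
  proof (intro conjI ballI allI impI)
    show "set (map d rs) \<subseteq> d ` Z" using rsZ by auto
  next
    fix w assume "w \<in> d ` Z"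
    then obtain v where v: "v \<in> Z" "w = d v" by blast
    then show "\<exists>c. w - comb (map d rs) c \<in> {0}"
      using coord_mod [OF rs v(1)] iff [OF v(1)] by blast
  next
    fix c i assume "comb (map d rs) c \<in> {0}" "i < length (map d rs)"
    then show "c i = 0" using rs iff0 unfolding basis_mod_def by simp
  qed
  have TN: "T ` ?N \<subseteq> ?N" using TZ comm by (auto simp: T'.zero)
  have "coord_mod {0} (map d rs) (T' (d (rs ! i))) i = coord_mod ?N rs (T (rs ! i)) i"
    if i: "i < length rs" for i
  proof -
    have "rs ! i \<in> Z" using rsZ i by auto
    then have "T (rs ! i) \<in> Z" using TZ by blast
    then have "d (T (rs ! i)) - comb (map d rs) (coord_mod ?N rs (T (rs ! i))) \<in> {0}"
      using coord_mod [OF rs] iff by blast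
    from coord_mod_eq [OF subspace_single_0 B this] i comm [OF \<open>rs ! i \<in> Z\<close>]
    show ?thesis by simp
  qed
  then have "trace_wrt {0} (map d rs) T' = trace_wrt ?N rs T"
    unfolding trace_wrt_def by simp
  moreover have "T' ` d ` Z \<subseteq> d ` Z"
  proof clarsimp
    fix v assume "v \<in> Z"
    then have "T' (d v) = d (T v)" "T v \<in> Z" using comm TZ by auto
    then show "T' (d v) \<in> d ` Z" by simp
  qed
  ultimately show ?thesis
    using trace_mod_eq [OF N rs T TZ TN] trace_mod_eq [OF subspace_single_0 B T']
    by (simp add: T'.zero)
qed

lemma trace_mod_null:
  assumes "module_hom scale scale T"
  shows "trace_mod {0} {0} T = 0"
proof -
  interpret T: module_hom scale scale T by fact
  have "basis_mod {0} {0} []" by (simp add: basis_mod_def comb_def)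
  from trace_mod_eq [OF subspace_single_0 this assms] show ?thesis
    by (simp add: T.zero trace_wrt_def)
qed

text \<open>It serves to replace the pullback by its composite with antisymmetrization, which agrees
  with it on cochains.\<close>

lemma trace_mod_cong:
  assumes "subspace N" "basis_mod Z N rs"
    and "module_hom scale scale T" "T ` Z \<subseteq> Z" "T ` N \<subseteq> N"
    and "module_hom scale scale T'" and "\<And>v. v \<in> Z \<Longrightarrow> T v = T' v" and "N \<subseteq> Z"
  shows "trace_mod Z N T = trace_mod Z N T'"
proof -
  have "T' ` Z \<subseteq> Z" "T' ` N \<subseteq> N" using assms by force+
  moreover have "rs ! i \<in> Z" if "i < length rs" for i using assms(2) that by (auto simp: basis_mod_def)
  ultimately show ?thesis
    using trace_mod_eq [OF assms(1,2,3,4,5)] trace_mod_eq [OF assms(1,2,6)] assms(7)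
    by (simp add: trace_wrt_def)
qed

text \<open>T induces zero on Z / M, so only M contributes. Hence a trace on M may be computed in a
  convenient basis of a larger space.\<close>

lemma trace_mod_range:
  assumes M: "subspace M" and Z: "subspace Z" and MZ: "M \<subseteq> Z"
    and F: "finite F" "Z \<subseteq> span F"
    and T: "module_hom scale scale T" and TZ: "T ` Z \<subseteq> M"
  shows "trace_mod Z {0} T = trace_mod M {0} T"
proof -
  interpret T: module_hom scale scale T by fact
  obtain rs where rs: "basis_mod Z M rs" using basis_mod_exists [OF M Z MZ F] by blast
  have "coord_mod M rs (T (rs ! i)) i = 0" if i: "i < length rs" for i
  proof -
    have "rs ! i \<in> Z" using i rs by (auto simp: basis_mod_def)
    then have "T (rs ! i) - comb rs (\<lambda>_. 0) \<in> M" using TZ by (auto simp: comb_def)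
    from coord_mod_eq [OF M rs this i] show ?thesis .
  qed
  then have "trace_wrt M rs T = 0" by (simp add: trace_wrt_def)
  moreover have TZ': "T ` Z \<subseteq> Z" and TM: "T ` M \<subseteq> M" using TZ MZ by blast+
  ultimately have "trace_mod Z M T = 0" using trace_mod_eq [OF M rs T] by simp
  moreover have "trace_mod Z {0} T = trace_mod M {0} T + trace_mod Z M T"
    by (rule trace_mod_add [OF subspace_single_0 M Z _ MZ F T TZ' TM])
      (use M in \<open>auto simp: subspace_0 T.zero\<close>)
  ultimately show ?thesis by simp
qed

end

section \<open>Traces on quotient modules\<close>

locale real_linear_trace = linear_trace scale
  for scale :: "real \<Rightarrow> 'b::ab_group_add \<Rightarrow> 'b" (infixr "*s" 75)
begin

text \<open>The undefined fields match those of \<open>cochains\<close>, so that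
  \<open>cocycle_space_eq\<close> becomes an equation between records.\<close>

definition subspace_module :: "'b set \<Rightarrow> (real, 'b) module" where
  "subspace_module Z =
     \<lparr>carrier = Z, mult = undefined, one = undefined, zero = 0, add = (+), smult = scale\<rparr>"

definition coset :: "'b set \<Rightarrow> 'b \<Rightarrow> 'b set" where
  "coset N v = (\<lambda>h. h + v) ` N"

lemma coset_eq_iff:
  assumes N: "subspace N"
  shows "coset N v = coset N w \<longleftrightarrow> v - w \<in> N"
proof
  assume "coset N v = coset N w"
  moreover have "v \<in> coset N v" using subspace_0 [OF N] by (force simp: coset_def)
  ultimately show "v - w \<in> N" by (auto simp: coset_def)
next
  assume vw: "v - w \<in> N"
  have "h + v \<in> coset N w" if "h \<in> N" for h
    using subspace_add [OF N that vw] unfolding coset_def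
    by (intro image_eqI [of _ _ "h + (v - w)"]) (auto simp: algebra_simps)
  moreover have "h + w \<in> coset N v" if "h \<in> N" for h
    using subspace_diff [OF N that vw] unfolding coset_def
    by (intro image_eqI [of _ _ "h - (v - w)"]) (auto simp: algebra_simps)
  ultimately show "coset N v = coset N w" by (auto simp: coset_def)
qed

lemma mem_coset_iff: "x \<in> coset N v \<longleftrightarrow> x - v \<in> N"
  unfolding coset_def by (metis (no_types, lifting) add_diff_cancel_right' diff_add_cancel image_iff)

lemma self_mem_coset: "subspace N \<Longrightarrow> v \<in> coset N v"
  by (simp add: mem_coset_iff subspace_0)

lemma a_r_coset_subspace_module: "N +>\<^bsub>subspace_module Z\<^esub> v = coset N v"
  by (auto simp: a_r_coset_def r_coset_def subspace_module_def coset_def)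

abbreviation quotient :: "'b set \<Rightarrow> 'b set \<Rightarrow> (real, 'b set) module" where
  "quotient Z N \<equiv> quotient_space (subspace_module Z) N"

lemma carrier_quotient: "carrier (quotient Z N) = coset N ` Z"
  by (auto simp: quotient_space_def A_RCOSETS_def RCOSETS_def
      a_r_coset_subspace_module [unfolded a_r_coset_def])
    (auto simp: subspace_module_def)

lemma zero_quotient: "\<zero>\<^bsub>quotient Z N\<^esub> = coset N 0"
  by (simp add: quotient_space_def coset_def)

lemma add_quotient:
  assumes N: "subspace N"
  shows "coset N v \<oplus>\<^bsub>quotient Z N\<^esub> coset N w = coset N (v + w)"
proof -
  have "coset N v \<oplus>\<^bsub>quotient Z N\<^esub> coset N w = {x + y | x y. x \<in> coset N v \<and> y \<in> coset N w}"
    by (auto simp: quotient_space_def set_add_def set_mult_def subspace_module_def)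
  also have "\<dots> = coset N (v + w)"
  proof safe
    fix x y assume "x \<in> coset N v" "y \<in> coset N w"
    then have "(x - v) + (y - w) \<in> N" using subspace_add [OF N] by (simp add: mem_coset_iff)
    then show "x + y \<in> coset N (v + w)" by (simp add: mem_coset_iff algebra_simps)
  next
    fix z assume "z \<in> coset N (v + w)"
    then have "z - w \<in> coset N v" "w \<in> coset N w"
      using subspace_0 [OF N] by (simp_all add: mem_coset_iff algebra_simps)
    moreover have "z = (z - w) + w" by simp
    ultimately show "\<exists>x y. z = x + y \<and> x \<in> coset N v \<and> y \<in> coset N w" by blast
  qed
  finally show ?thesis .
qed

text \<open>The record takes a union over all representatives of the coset. They all yield the same
  coset and at least one exists, so the union collapses; \<open>quotient_map\<close> is computed in
  the same way.\<close>

lemma smult_quotient: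
  assumes N: "subspace N"
  shows "c \<odot>\<^bsub>quotient Z N\<^esub> coset N v = coset N (c *s v)"
proof -
  have "c \<odot>\<^bsub>quotient Z N\<^esub> coset N v = (\<Union>x\<in>coset N v. coset N (c *s x))"
    by (simp add: quotient_space_def a_r_coset_subspace_module) (simp add: subspace_module_def)
  also have "coset N (c *s x) = coset N (c *s v)" if "x \<in> coset N v" for x
    using that subspace_scale [OF N, of "x - v" c]
    by (simp add: coset_eq_iff [OF N] mem_coset_iff scale_right_diff_distrib)
  then have "(\<Union>x\<in>coset N v. coset N (c *s x)) = (\<Union>x\<in>coset N v. coset N (c *s v))" by auto
  also have "\<dots> = coset N (c *s v)"
    using self_mem_coset [OF N] by blast
  finally show ?thesis .
qed

lemma quotient_map_coset:
  assumes N: "subspace N" and T: "module_hom scale scale T" and TN: "T ` N \<subseteq> N"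
  shows "quotient_map (subspace_module Z) N T (coset N v) = coset N (T v)"
proof -
  interpret T: module_hom scale scale T by fact
  have "coset N (T x) = coset N (T v)" if "x \<in> coset N v" for x
  proof -
    have "T (x - v) \<in> N" using that TN by (auto simp: mem_coset_iff)
    then show ?thesis by (simp add: coset_eq_iff [OF N] T.diff)
  qed
  then have "quotient_map (subspace_module Z) N T (coset N v) = (\<Union>x\<in>coset N v. coset N (T v))"
    by (auto simp: quotient_map_def a_r_coset_subspace_module)
  also have "\<dots> = coset N (T v)"
    using self_mem_coset [OF N] by blast
  finally show ?thesis .
qed

text \<open>This is the structure that the finite sum in \<open>lin_comb\<close> requires.\<close>

lemma abelian_monoid_quotient:
  assumes N: "subspace N" and Z: "subspace Z"
  shows "abelian_monoid (quotient Z N)"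
  using subspace_0 [OF Z]
  by (intro abelian_monoidI)
    (auto simp: carrier_quotient zero_quotient add_quotient [OF N] ac_simps
      intro!: imageI subspace_add [OF Z])

lemma lin_comb_quotient:
  assumes N: "subspace N" and Z: "subspace Z" and rs: "set rs \<subseteq> Z"
  shows "lin_comb (quotient Z N) (map (coset N) rs) c = coset N (comb rs c)"
proof -
  interpret Q: abelian_monoid "quotient Z N" by (rule abelian_monoid_quotient [OF N Z])
  let ?f = "\<lambda>i. c i \<odot>\<^bsub>quotient Z N\<^esub> map (coset N) rs ! i"
  have f: "?f i = coset N (c i *s rs ! i)" if "i < length rs" for i
    using that by (simp add: smult_quotient [OF N])
  have mem: "?f i \<in> carrier (quotient Z N)" if "i < length rs" for i
    unfolding f [OF that] carrier_quotient using that rs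
    by (auto intro!: imageI subspace_scale [OF Z])
  have "(\<Oplus>\<^bsub>quotient Z N\<^esub>i\<in>{..<n}. ?f i) = coset N (\<Sum>i<n. c i *s rs ! i)"
    if "n \<le> length rs" for n
    using that
  proof (induction n)
    case 0
    then show ?case by (simp add: zero_quotient)
  next
    case (Suc n)
    have *: "?f \<in> {..<n} \<rightarrow> carrier (quotient Z N)" "?f n \<in> carrier (quotient Z N)"
      using Suc.prems mem by auto
    show ?case
      unfolding lessThan_Suc using Suc f [of n]
      by (subst Q.finsum_insert [OF _ _ *]) (simp_all add: add_quotient [OF N] add.commute)
  qed
  from this [of "length rs"] show ?thesis by (simp add: lin_comb_def comb_def)
qed

text \<open>Unique coordinates are compared with spanning and independence modulo N. Independence
  follows from uniqueness at the zero coset alone; restriction makes coefficient functions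
  extensional without changing the combination.\<close>

lemma is_basis_quotient_iff:
  assumes N: "subspace N" and Z: "subspace Z" and rs: "set rs \<subseteq> Z"
  shows "is_basis (quotient Z N) (map (coset N) rs) \<longleftrightarrow> basis_mod Z N rs"
proof -
  have "is_basis (quotient Z N) (map (coset N) rs) \<longleftrightarrow>
      (\<forall>v\<in>Z. \<exists>!c. c \<in> extensional {..<length rs} \<and> v - comb rs c \<in> N)"
    using rs unfolding is_basis_def
    by (auto simp: carrier_quotient lin_comb_quotient [OF N Z rs] coset_eq_iff [OF N])
  also have "\<dots> \<longleftrightarrow> basis_mod Z N rs"
  proof
    assume L: "\<forall>v\<in>Z. \<exists>!c. c \<in> extensional {..<length rs} \<and> v - comb rs c \<in> N"
    have "c i = 0" if c: "comb rs c \<in> N" and i: "i < length rs" for c i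
    proof -
      have eq: "comb rs (restrict c {..<length rs}) = comb rs c" for c by (rule comb_cong) simp
      have c0: "comb rs (\<lambda>_. 0) = 0" by (simp add: comb_def)
      have "0 - comb rs (restrict c {..<length rs}) \<in> N"
        unfolding eq using subspace_neg [OF N c] by simp
      moreover have "0 - comb rs (restrict (\<lambda>_. 0) {..<length rs}) \<in> N"
        unfolding eq using subspace_0 [OF N] c0 by simp
      ultimately have "restrict c {..<length rs} = restrict (\<lambda>_. 0) {..<length rs}"
        using L subspace_0 [OF Z] by (metis restrict_extensional)
      then have "restrict c {..<length rs} i = restrict (\<lambda>_. 0) {..<length rs} i" by simp
      then show ?thesis using i by simp
    qed
    then show "basis_mod Z N rs" using L rs unfolding basis_mod_def by blast
  next
    assume B: "basis_mod Z N rs"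
    show "\<forall>v\<in>Z. \<exists>!c. c \<in> extensional {..<length rs} \<and> v - comb rs c \<in> N"
    proof (intro ballI ex_ex1I)
      fix v assume "v \<in> Z"
      moreover have "comb rs (restrict c {..<length rs}) = comb rs c" for c by (rule comb_cong) simp
      ultimately show "\<exists>c. c \<in> extensional {..<length rs} \<and> v - comb rs c \<in> N"
        using coord_mod [OF B] by (intro exI [of _ "restrict (coord_mod N rs v) {..<length rs}"]) auto
    next
      fix v c c' assume "c \<in> extensional {..<length rs} \<and> v - comb rs c \<in> N"
        "c' \<in> extensional {..<length rs} \<and> v - comb rs c' \<in> N"
      then have c: "c \<in> extensional {..<length rs}" "c' \<in> extensional {..<length rs}"
        and *: "v - comb rs c \<in> N" "v - comb rs c' \<in> N" by blast+
      show "c = c'"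
        using coord_mod_eq [OF N B *(1)] coord_mod_eq [OF N B *(2)]
        by (intro extensionalityI [OF c]) force
    qed
  qed
  finally show ?thesis .
qed

lemma coords_quotient:
  assumes N: "subspace N" and Z: "subspace Z" and B: "basis_mod Z N rs"
    and v: "v \<in> Z" and i: "i < length rs"
  shows "coords (quotient Z N) (map (coset N) rs) (coset N v) i = coord_mod N rs v i"
proof -
  let ?P = "\<lambda>c. c \<in> extensional {..<length (map (coset N) rs)} \<and>
    coset N v = lin_comb (quotient Z N) (map (coset N) rs) c"
  have rs: "set rs \<subseteq> Z" using B by (simp add: basis_mod_def)
  have "is_basis (quotient Z N) (map (coset N) rs)"
    unfolding is_basis_quotient_iff [OF N Z rs] by (rule B)
  moreover have "coset N v \<in> carrier (quotient Z N)" using v by (simp add: carrier_quotient)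
  ultimately have "\<exists>!c. ?P c" unfolding is_basis_def by (elim conjE bspec)
  then have "?P (coords (quotient Z N) (map (coset N) rs) (coset N v))"
    unfolding coords_def by (rule theI')
  then have "v - comb rs (coords (quotient Z N) (map (coset N) rs) (coset N v)) \<in> N"
    by (simp add: lin_comb_quotient [OF N Z rs] coset_eq_iff [OF N])
  from coord_mod_eq [OF N B this i] show ?thesis by simp
qed

text \<open>The basis chosen by \<open>trace_on\<close> is some list of cosets. Picking a
  representative in Z of each gives a list \<open>rs\<close> for which \<open>trace_wrt\<close>
  applies, and the trace does not depend on which basis was chosen.\<close>

lemma trace_on_quotient:
  assumes N: "subspace N" and Z: "subspace Z" and NZ: "N \<subseteq> Z" and F: "finite F" "Z \<subseteq> span F"
    and T: "module_hom scale scale T" and TZ: "T ` Z \<subseteq> Z" and TN: "T ` N \<subseteq> N"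
  shows "trace_on (quotient Z N) (quotient_map (subspace_module Z) N T) = trace_mod Z N T"
proof -
  define bs where "bs = (SOME bs. is_basis (quotient Z N) bs)"
  \<comment> \<open>Some basis must exist for the choice \<open>bs\<close> to be a basis.\<close>
  obtain rs' where rs': "basis_mod Z N rs'" using basis_mod_exists [OF N Z NZ F] by blast
  then have "is_basis (quotient Z N) (map (coset N) rs')"
    using is_basis_quotient_iff [OF N Z] by (simp add: basis_mod_def)
  then have bs: "is_basis (quotient Z N) bs" unfolding bs_def by (rule someI)
  then have "set bs \<subseteq> coset N ` Z" by (simp add: is_basis_def carrier_quotient)
  then have "bs \<in> map (coset N) ` lists Z" by (metis lists_image in_listsI subsetD)
  then obtain rs where bs_eq: "bs = map (coset N) rs" and "rs \<in> lists Z" by blast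
  then have rs: "set rs \<subseteq> Z" by (simp add: lists_eq_set)
  have B: "basis_mod Z N rs" using bs is_basis_quotient_iff [OF N Z rs] by (simp add: bs_eq)
  have "coords (quotient Z N) bs (quotient_map (subspace_module Z) N T (bs ! i)) i =
      coord_mod N rs (T (rs ! i)) i" if i: "i < length rs" for i
  proof -
    have "rs ! i \<in> Z" using rs i by auto
    then have "T (rs ! i) \<in> Z" using TZ by blast
    from coords_quotient [OF N Z B this i] show ?thesis
      by (simp add: bs_eq i quotient_map_coset [OF N T TN])
  qed
  then have "trace_on (quotient Z N) (quotient_map (subspace_module Z) N T) = trace_wrt N rs T"
    unfolding trace_on_def bs_def [symmetric] Let_def trace_wrt_def
    by (simp add: bs_eq)
  then show ?thesis using trace_mod_eq [OF N B T TZ TN] by simp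
qed

end

section \<open>The cochain complex\<close>

lemma permute_ordered_clique:
  assumes "xs \<in> ordered_cliques K n" "p permutes {..<n}"
  shows "permute_list p xs \<in> ordered_cliques K n"
  using assms by (auto simp: ordered_cliques_def)

lemma map_ordered_clique:
  assumes "xs \<in> ordered_cliques K n" "inj_on T (verts K)" "graph_hom K K T"
  shows "map T xs \<in> ordered_cliques K n"
proof -
  have "distinct (map T xs)"
    using assms by (auto simp: ordered_cliques_def distinct_map intro: inj_on_subset)
  moreover have "{T x, T y} \<in> edges K" if "{x, y} \<in> edges K" for x y
  proof -
    have "T ` {x, y} \<in> edges K" using assms(3) that unfolding graph_hom_def by blast
    then show ?thesis by simp
  qed
  moreover have "T ` set xs \<subseteq> verts K"
    using assms(1,3) unfolding ordered_cliques_def graph_hom_def by blast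
  ultimately show ?thesis using assms(1) unfolding ordered_cliques_def by simp metis
qed

definition delete_at :: "nat \<Rightarrow> 'a list \<Rightarrow> 'a list" where
  "delete_at j xs = take j xs @ drop (Suc j) xs"

lemma delete_at_append: "j = length us \<Longrightarrow> delete_at j (us @ x # vs) = us @ vs"
  by (simp add: delete_at_def)

lemma delete_at_ordered_clique:
  assumes "xs \<in> ordered_cliques K (Suc n)" "j \<le> n"
  shows "delete_at j xs \<in> ordered_cliques K n"
proof -
  have j: "j < length xs" using assms by (simp add: ordered_cliques_def)
  obtain us x vs where "xs = us @ x # vs" "length us = j"
    using id_take_nth_drop [OF j] j by (metis length_take min.absorb4)
  then show ?thesis using assms(1) by (auto simp: delete_at_append ordered_cliques_def)
qed

text \<open>The simplicial identity for faces, which pairs the terms of the iterated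
  derivative.\<close>

lemma delete_at_delete_at:
  assumes "i \<le> j" "Suc j < length xs"
  shows "delete_at j (delete_at i xs) = delete_at i (delete_at (Suc j) xs)"
  using assms by (intro nth_equalityI) (auto simp: delete_at_def nth_append min_def)

lemma map_delete_at: "map T (delete_at j xs) = delete_at j (map T xs)"
  by (simp add: delete_at_def take_map drop_map)

lemma ext_deriv_eq:
  "ext_deriv K k f xs = (if xs \<in> ordered_cliques K (Suc (Suc k))
     then \<Sum>j\<le>Suc k. (-1) ^ j * f (delete_at j xs) else 0)"
  by (simp add: ext_deriv_def delete_at_def)

text \<open>The sign rule of a cochain without the support condition; n is the length of the lists,
  one more than the degree.\<close>

definition alternating :: "'v graph \<Rightarrow> nat \<Rightarrow> ('v list \<Rightarrow> real) \<Rightarrow> bool" where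
  "alternating K n f \<longleftrightarrow> (\<forall>xs\<in>ordered_cliques K n. \<forall>p. p permutes {..<n} \<longrightarrow>
     f (permute_list p xs) = of_int (sign p) * f xs)"

lemma carrier_cochains:
  "carrier (cochains K k) =
     {f. (\<forall>xs. xs \<notin> ordered_cliques K (Suc k) \<longrightarrow> f xs = 0) \<and> alternating K (Suc k) f}"
  by (simp add: cochains_def alternating_def)

lemma permute_list_adjacent:
  "permute_list (Transposition.transpose (length us) (Suc (length us))) (us @ x # y # vs) =
     us @ y # x # vs"
proof (rule nth_equalityI)
  let ?p = "Transposition.transpose (length us) (Suc (length us))"
  fix i assume "i < length (permute_list ?p (us @ x # y # vs))"
  moreover have "?p permutes {..<length (us @ x # y # vs)}" by (rule permutes_swap_id) auto
  ultimately have eq: "permute_list ?p (us @ x # y # vs) ! i = (us @ x # y # vs) ! ?p i"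
    by (simp only: permute_list_nth length_permute_list)
  consider "i < length us" | "i = length us" | "i = Suc (length us)"
    | "Suc (length us) < i" by linarith
  then have "(us @ x # y # vs) ! ?p i = (us @ y # x # vs) ! i"
  proof cases
    case 4
    then obtain m where "i = Suc (Suc (length us) + m)" using less_imp_Suc_add by blast
    then show ?thesis by (simp add: nth_append)
  qed (simp_all add: nth_append)
  then show "permute_list ?p (us @ x # y # vs) ! i = (us @ y # x # vs) ! i" by (simp only: eq)
qed simp

lemma alternating_adjacent:
  assumes "alternating K n f" "us @ x # y # vs \<in> ordered_cliques K n"
  shows "f (us @ y # x # vs) = - f (us @ x # y # vs)"
proof -
  let ?p = "Transposition.transpose (length us) (Suc (length us))"
  have "?p permutes {..<n}"
    using assms(2) by (intro permutes_swap_id) (auto simp: ordered_cliques_def)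
  then have "f (permute_list ?p (us @ x # y # vs)) = of_int (sign ?p) * f (us @ x # y # vs)"
    using assms by (simp add: alternating_def)
  then show ?thesis by (simp add: permute_list_adjacent sign_swap_id)
qed

text \<open>Adjacent transpositions generate the symmetric group, and the permutations obeying the
  sign rule on all cliques are closed under composition. This reduces the sign rule for the
  derivative to a swap of neighbours.\<close>

lemma alternatingI:
  assumes "\<And>us x y vs. us @ x # y # vs \<in> ordered_cliques K n \<Longrightarrow>
    f (us @ y # x # vs) = - f (us @ x # y # vs)"
  shows "alternating K n f"
proof -
  define Q where "Q p \<longleftrightarrow> p permutes {..<n} \<and>
    (\<forall>xs\<in>ordered_cliques K n. f (permute_list p xs) = of_int (sign p) * f xs)" for p
  have comp: "Q (p \<circ> q)" if "Q p" "Q q" for p q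
  proof -
    have pq: "p permutes {..<n}" "q permutes {..<n}" using that by (auto simp: Q_def)
    then have "permutation p" "permutation q" by (auto simp: permutation_permutes)
    then have sgn: "sign (p \<circ> q) = sign p * sign q" by (rule sign_compose)
    have "f (permute_list (p \<circ> q) xs) = of_int (sign (p \<circ> q)) * f xs"
      if xs: "xs \<in> ordered_cliques K n" for xs
    proof -
      have len: "length xs = n" using xs by (simp add: ordered_cliques_def)
      have "permute_list p xs \<in> ordered_cliques K n" by (rule permute_ordered_clique [OF xs pq(1)])
      then show ?thesis
        using \<open>Q p\<close> \<open>Q q\<close> xs pq len
        by (simp add: Q_def permute_list_compose sgn)
    qed
    then show ?thesis using permutes_compose [OF pq(2,1)] by (simp add: Q_def)
  qed
  have adj: "Q (Transposition.transpose i (Suc i))" if i: "Suc i < n" for i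
    unfolding Q_def
  proof (intro conjI ballI)
    show "Transposition.transpose i (Suc i) permutes {..<n}"
      using i by (intro permutes_swap_id) auto
    fix xs assume xs: "xs \<in> ordered_cliques K n"
    let ?us = "take i xs" and ?vs = "drop (Suc (Suc i)) xs"
    have len: "length xs = n" using xs by (simp add: ordered_cliques_def)
    then have eq: "xs = ?us @ xs ! i # xs ! Suc i # ?vs"
      using i by (metis Cons_nth_drop_Suc Suc_lessD append_take_drop_id)
    have "length ?us = i" using i len by simp
    then have "permute_list (Transposition.transpose i (Suc i)) xs = ?us @ xs ! Suc i # xs ! i # ?vs"
      using eq permute_list_adjacent [of ?us] by metis
    moreover have "f (?us @ xs ! Suc i # xs ! i # ?vs) = - f (?us @ xs ! i # xs ! Suc i # ?vs)"
      using assms eq xs by metis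
    ultimately show "f (permute_list (Transposition.transpose i (Suc i)) xs) =
        of_int (sign (Transposition.transpose i (Suc i))) * f xs"
      using eq by (simp add: sign_swap_id)
  qed
  have less: "Q (Transposition.transpose a b)" if "a < b" "b < n" for a b
    using that
  proof (induction b)
    case (Suc b)
    show ?case
    proof (cases "a = b")
      case False
      then have "Q (Transposition.transpose a b)" using Suc by simp
      \<comment> \<open>Conjugating the swap of b and b + 1 by the swap of a and b gives the swap of
        a and b + 1.\<close>
      then have "Q (Transposition.transpose a b \<circ> Transposition.transpose b (Suc b) \<circ>
          Transposition.transpose a b)"
        using adj Suc.prems by (intro comp) auto
      then show ?thesis using Suc.prems by (simp add: transpose_comp_triple)
    qed (use adj Suc.prems in simp)
  qed simp
  have all: "Q p" if "p permutes {..<n}" for p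
    using that finite_lessThan
  proof (induction rule: permutes_induct)
    case id
    show ?case unfolding Q_def by (intro conjI permutes_id) simp
  next
    case (swap a b p)
    then have "Q (Transposition.transpose a b)"
      using less by (metis lessThan_iff linorder_neqE_nat transpose_commute)
    then show ?case using swap comp by blast
  qed
  then show ?thesis by (simp add: alternating_def Q_def)
qed

text \<open>Swapping the neighbours at i and i + 1 exchanges the faces i and i + 1, whose signs are
  opposite. In every other face two neighbours are swapped, which changes the sign of f. So term j
  becomes minus term \<open>?t j\<close>, and \<open>?t\<close> permutes the indices.\<close>

lemma ext_deriv_alternating:
  assumes f: "alternating K (Suc k) f"
  shows "alternating K (Suc (Suc k)) (ext_deriv K k f)"
proof (rule alternatingI)
  fix us vs :: "'a list" and x y
  let ?i = "length us" and ?xs = "us @ x # y # vs" and ?ys = "us @ y # x # vs"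
  let ?t = "Transposition.transpose ?i (Suc ?i)"
  assume xs: "?xs \<in> ordered_cliques K (Suc (Suc k))"
  then have len: "?i + length vs = k" by (simp add: ordered_cliques_def)
  have ys: "?ys \<in> ordered_cliques K (Suc (Suc k))"
    using permute_ordered_clique [OF xs, of ?t] len
    by (simp add: permute_list_adjacent permutes_swap_id)
  have "(-1) ^ j * f (delete_at j ?ys) = - ((-1) ^ ?t j * f (delete_at (?t j) ?xs))"
    if j: "j \<le> Suc k" for j
  proof -
    have clique: "delete_at j ?xs \<in> ordered_cliques K (Suc k)"
      using delete_at_ordered_clique [OF xs j] .
    consider "j < ?i" | "j = ?i" | "j = Suc ?i" | "Suc ?i < j" by linarith
    then show ?thesis
    proof cases
      case 1
      then have us: "us = take j us @ us ! j # drop (Suc j) us" by (rule id_take_nth_drop)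
      have del: "delete_at j (us @ zs) = (take j us @ drop (Suc j) us) @ zs" for zs
        using 1 by (simp add: delete_at_def)
      have "f (delete_at j ?ys) = - f (delete_at j ?xs)"
        using alternating_adjacent [OF f] clique unfolding del by blast
      then show ?thesis using 1 by simp
    next
      case 2
      have "delete_at ?i ?ys = us @ x # vs" by (simp add: delete_at_append)
      moreover have "delete_at (Suc ?i) ?xs = us @ x # vs"
        using delete_at_append [of "Suc ?i" "us @ [x]" y vs] by simp
      ultimately show ?thesis using 2 by simp
    next
      case 3
      have "delete_at ?i ?xs = us @ y # vs" by (simp add: delete_at_append)
      moreover have "delete_at (Suc ?i) ?ys = us @ y # vs"
        using delete_at_append [of "Suc ?i" "us @ [y]" x vs] by simp
      ultimately show ?thesis using 3 by simp
    next
      case 4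
      define m where "m = j - Suc (Suc ?i)"
      have j_eq: "j = Suc (Suc (?i + m))" using 4 by (simp add: m_def)
      have del: "delete_at j (us @ a # b # vs) = us @ a # b # delete_at m vs" for a b
        by (simp add: j_eq delete_at_def numeral_3_eq_3)
      have "f (delete_at j ?ys) = - f (delete_at j ?xs)"
        using alternating_adjacent [OF f] clique unfolding del by blast
      then show ?thesis using 4 by simp
    qed
  qed
  then have "ext_deriv K k f ?ys = (\<Sum>j\<le>Suc k. - ((-1) ^ ?t j * f (delete_at (?t j) ?xs)))"
    using ys by (simp add: ext_deriv_eq del: sum.atMost_Suc)
  also have "\<dots> = - (\<Sum>j\<le>Suc k. (-1) ^ j * f (delete_at j ?xs))"
    unfolding sum_negf
    using sum.permute [of ?t "{..Suc k}" "\<lambda>j. (-1) ^ j * f (delete_at j ?xs)"] len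
    by (simp add: permutes_swap_id o_def del: sum.atMost_Suc)
  finally show "ext_deriv K k f ?ys = - ext_deriv K k f ?xs"
    using xs by (simp add: ext_deriv_eq del: sum.atMost_Suc)
qed

lemma ext_deriv_cochain:
  "f \<in> carrier (cochains K k) \<Longrightarrow> ext_deriv K k f \<in> carrier (cochains K (Suc k))"
  by (simp add: carrier_cochains ext_deriv_alternating) (simp add: ext_deriv_def)

lemma ext_deriv_ext_deriv: "ext_deriv K (Suc k) (ext_deriv K k f) = (\<lambda>_. 0)"
proof
  fix xs
  show "ext_deriv K (Suc k) (ext_deriv K k f) xs = 0"
  proof (cases "xs \<in> ordered_cliques K (Suc (Suc (Suc k)))")
    case True
    then have len: "length xs = Suc (Suc (Suc k))" by (simp add: ordered_cliques_def)
    let ?g = "\<lambda>(i, j). (-1) ^ (i + j) * f (delete_at j (delete_at i xs))"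
    let ?S = "{..Suc (Suc k)} \<times> {..Suc k}"
    let ?A = "{(i, j) \<in> ?S. j < i}" and ?B = "{(i, j) \<in> ?S. i \<le> j}"
    have "ext_deriv K (Suc k) (ext_deriv K k f) xs =
        (\<Sum>i\<le>Suc (Suc k). (-1) ^ i * ext_deriv K k f (delete_at i xs))"
      using True by (subst ext_deriv_eq) (simp del: sum.atMost_Suc)
    also have "\<dots> = (\<Sum>i\<le>Suc (Suc k). \<Sum>j\<le>Suc k. ?g (i, j))"
    proof (intro sum.cong HOL.refl)
      fix i assume "i \<in> {..Suc (Suc k)}"
      then have "delete_at i xs \<in> ordered_cliques K (Suc (Suc k))"
        using delete_at_ordered_clique [OF True] by simp
      then show "(-1) ^ i * ext_deriv K k f (delete_at i xs) = (\<Sum>j\<le>Suc k. ?g (i, j))"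
        by (simp add: ext_deriv_eq sum_distrib_left power_add mult.assoc del: sum.atMost_Suc)
    qed
    also have "\<dots> = sum ?g ?S" by (simp add: sum.cartesian_product del: sum.atMost_Suc)
    also have "\<dots> = sum ?g ?A + sum ?g ?B"
    proof -
      have "sum ?g (?A \<union> ?B) = sum ?g ?A + sum ?g ?B"
      proof (rule sum.union_disjoint)
        show "finite ?A" "finite ?B" by (rule finite_subset [of _ ?S]; blast)+
      qed auto
      moreover have "?A \<union> ?B = ?S" by auto
      ultimately show ?thesis by (simp only:)
    qed
    \<comment> \<open>For i \<le> j the pairs (i, j) and (j + 1, i) delete the same two entries, in
      the two possible orders, and carry opposite signs.\<close>
    also have "sum ?g ?A = (\<Sum>q\<in>?B. ?g (Suc (snd q), fst q))"
      by (rule sum.reindex_bij_witness [symmetric,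
            of _ "\<lambda>q. (snd q, fst q - 1)" "\<lambda>q. (Suc (snd q), fst q)"]) auto
    also have "\<dots> = (\<Sum>q\<in>?B. - ?g q)"
    proof (intro sum.cong HOL.refl)
      fix q assume "q \<in> ?B"
      then obtain i j where q: "q = (i, j)" "i \<le> j" "j \<le> Suc k" by auto
      then have "delete_at j (delete_at i xs) = delete_at i (delete_at (Suc j) xs)"
        using len by (intro delete_at_delete_at) simp_all
      then show "?g (Suc (snd q), fst q) = - ?g q" using q(1) by (simp add: add.commute)
    qed
    finally show ?thesis by (simp add: sum_negf)
  qed (simp add: ext_deriv_def)
qed

section \<open>Pullback, and projection onto the alternating functions\<close>

lemma ext_deriv_pullback:
  assumes "inj_on T (verts K)" "graph_hom K K T"
  shows "ext_deriv K k (pullback K k T f) = pullback K (Suc k) T (ext_deriv K k f)"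
proof
  fix xs
  show "ext_deriv K k (pullback K k T f) xs = pullback K (Suc k) T (ext_deriv K k f) xs"
  proof (cases "xs \<in> ordered_cliques K (Suc (Suc k))")
    case True
    then show ?thesis
      using map_ordered_clique [OF True assms] delete_at_ordered_clique [OF True]
      by (simp add: ext_deriv_eq pullback_def map_delete_at del: sum.atMost_Suc)
  qed (simp add: ext_deriv_def pullback_def)
qed

lemma pullback_cochain:
  assumes "inj_on T (verts K)" "graph_hom K K T" "f \<in> carrier (cochains K k)"
  shows "pullback K k T f \<in> carrier (cochains K k)"
proof -
  have "pullback K k T f (permute_list p xs) = of_int (sign p) * pullback K k T f xs"
    if xs: "xs \<in> ordered_cliques K (Suc k)" and p: "p permutes {..<Suc k}" for xs p
  proof -
    have "p permutes {..<length xs}" using xs p by (simp add: ordered_cliques_def)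
    then show ?thesis
      using map_ordered_clique [OF xs assms(1,2)] permute_ordered_clique [OF xs p] xs p assms(3)
      by (simp add: pullback_def carrier_cochains alternating_def flip: permute_list_map)
  qed
  then show ?thesis by (simp add: carrier_cochains alternating_def) (simp add: pullback_def)
qed

text \<open>Division by the number of permutations makes this the identity on cochains.\<close>

definition antisymmetrize :: "'v graph \<Rightarrow> nat \<Rightarrow> ('v list \<Rightarrow> real) \<Rightarrow> 'v list \<Rightarrow> real" where
  "antisymmetrize K k f xs = (if xs \<in> ordered_cliques K (Suc k)
     then (\<Sum>p | p permutes {..<Suc k}. of_int (sign p) * f (permute_list p xs)) / fact (Suc k)
     else 0)"

lemma antisymmetrize_cochain: "antisymmetrize K k f \<in> carrier (cochains K k)"
proof -
  have "antisymmetrize K k f (permute_list q xs) = of_int (sign q) * antisymmetrize K k f xs"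
    if xs: "xs \<in> ordered_cliques K (Suc k)" and q: "q permutes {..<Suc k}" for xs q
  proof -
    let ?S = "{p. p permutes {..<Suc k}}"
    have len: "length xs = Suc k" using xs by (simp add: ordered_cliques_def)
    \<comment> \<open>Permuting by q and then by p is permuting by \<open>q \<circ> p\<close>, so
      the sum can be reindexed; the factor \<open>sign q\<close> is its own inverse.\<close>
    have "of_int (sign p) * f (permute_list p (permute_list q xs)) =
        of_int (sign q) * (of_int (sign (q \<circ> p)) * f (permute_list (q \<circ> p) xs))"
      if p: "p \<in> ?S" for p
    proof -
      have "permutation p" "permutation q"
        using p q by (auto simp: permutation_permutes simp del: lessThan_Suc)
      then have "of_int (sign q) * of_int (sign (q \<circ> p)) = (of_int (sign p) :: real)"
        by (simp add: sign_compose flip: of_int_mult)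
      then show ?thesis
        using p len by (simp add: permute_list_compose flip: mult.assoc del: lessThan_Suc)
    qed
    then have "(\<Sum>p\<in>?S. of_int (sign p) * f (permute_list p (permute_list q xs))) =
        of_int (sign q) * (\<Sum>p\<in>?S. of_int (sign (q \<circ> p)) * f (permute_list (q \<circ> p) xs))"
      by (simp add: sum_distrib_left del: lessThan_Suc)
    also have "\<dots> = of_int (sign q) * (\<Sum>p\<in>?S. of_int (sign p) * f (permute_list p xs))"
      using setum_permutations_compose_left [OF q, of "\<lambda>p. of_int (sign p) * f (permute_list p xs)"]
      by simp
    finally show ?thesis
      using xs permute_ordered_clique [OF xs q] by (simp add: antisymmetrize_def del: lessThan_Suc)
  qed
  then show ?thesis by (simp add: carrier_cochains alternating_def) (simp add: antisymmetrize_def)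
qed

lemma antisymmetrize_id:
  assumes "f \<in> carrier (cochains K k)"
  shows "antisymmetrize K k f = f"
proof
  fix xs
  show "antisymmetrize K k f xs = f xs"
  proof (cases "xs \<in> ordered_cliques K (Suc k)")
    case True
    have "of_int (sign p) * f (permute_list p xs) = f xs" if "p permutes {..<Suc k}" for p
    proof -
      have "of_int (sign p) * f (permute_list p xs) = of_int (sign p * sign p) * f xs"
        using assms True that by (simp add: carrier_cochains alternating_def del: sign_idempotent)
      then show ?thesis by simp
    qed
    then have "(\<Sum>p | p permutes {..<Suc k}. of_int (sign p) * f (permute_list p xs)) =
        real (card {p. p permutes {..<Suc k}}) * f xs"
      by simp
    also have "\<dots> = fact (Suc k) * f xs"
      using card_permutations [of "{..<Suc k}" "Suc k"] by (simp del: fact_Suc)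
    finally show ?thesis using True by (simp add: antisymmetrize_def del: fact_Suc)
  qed (use assms in \<open>simp add: antisymmetrize_def carrier_cochains\<close>)
qed

section \<open>Traces on spaces of functions\<close>

definition fun_scale :: "real \<Rightarrow> ('x \<Rightarrow> real) \<Rightarrow> 'x \<Rightarrow> real" where
  "fun_scale c f = (\<lambda>x. c * f x)"

interpretation fun_space: real_linear_trace fun_scale
  by unfold_locales (simp_all add: fun_scale_def fun_eq_iff algebra_simps)

lemma module_hom_fun_scaleI:
  assumes "\<And>f g. T (f + g) = T f + T g" "\<And>c f. T (fun_scale c f) = fun_scale c (T f)"
  shows "module_hom fun_scale fun_scale T"
  by unfold_locales (use assms in auto)

lemma sum_fun_apply: "(\<Sum>i\<in>I. f i :: 'x \<Rightarrow> real) x = (\<Sum>i\<in>I. f i x)"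
  by (induction I rule: infinite_finite_induct) auto

definition supported_on :: "'x set \<Rightarrow> ('x \<Rightarrow> real) set" where
  "supported_on S = {f. \<forall>x. x \<notin> S \<longrightarrow> f x = 0}"

definition point_mass :: "'x \<Rightarrow> 'x \<Rightarrow> real" where
  "point_mass x = (\<lambda>y. if y = x then 1 else 0)"

lemma subspace_supported_on: "fun_space.subspace (supported_on S)"
  by (auto simp: fun_space.subspace_def supported_on_def fun_scale_def)

lemma supported_on_span:
  assumes "finite S"
  shows "supported_on S \<subseteq> fun_space.span (point_mass ` S)"
proof
  fix f :: "'a \<Rightarrow> real" assume f: "f \<in> supported_on S"
  have "f = (\<Sum>x\<in>S. fun_scale (f x) (point_mass x))"
  proof
    fix y
    have "(\<Sum>x\<in>S. fun_scale (f x) (point_mass x)) y = (\<Sum>x\<in>S. if x = y then f x else 0)"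
      unfolding sum_fun_apply by (intro sum.cong) (auto simp: fun_scale_def point_mass_def)
    also have "\<dots> = f y" using f assms by (simp add: supported_on_def)
    finally show "f y = (\<Sum>x\<in>S. fun_scale (f x) (point_mass x)) y" by simp
  qed
  also have "\<dots> \<in> fun_space.span (point_mass ` S)"
    by (intro fun_space.span_sum fun_space.span_scale fun_space.span_base) auto
  finally show "f \<in> fun_space.span (point_mass ` S)" .
qed

text \<open>In the basis of point masses the coordinates of a function are its values.\<close>

lemma trace_mod_supported_on:
  fixes T :: "('x \<Rightarrow> real) \<Rightarrow> 'x \<Rightarrow> real"
  assumes S: "finite S" and T: "module_hom fun_scale fun_scale T"
    and TS: "T ` supported_on S \<subseteq> supported_on S"
  shows "fun_space.trace_mod (supported_on S) {0} T = (\<Sum>x\<in>S. T (point_mass x) x)"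
proof -
  interpret T: module_hom fun_scale fun_scale T by fact
  obtain xs where xs: "set xs = S" "distinct xs" using finite_distinct_list [OF S] by blast
  let ?ps = "map point_mass xs"
  have comb: "fun_space.comb ?ps c (xs ! i) = c i" if i: "i < length xs" for c i
  proof -
    have "fun_space.comb ?ps c (xs ! i) = (\<Sum>j<length xs. if j = i then c j else 0)"
      unfolding fun_space.comb_def sum_fun_apply
      using i xs(2) by (intro sum.cong) (auto simp: fun_scale_def point_mass_def nth_eq_iff_index_eq)
    then show ?thesis using i by simp
  qed
  have ps: "set ?ps \<subseteq> supported_on S" using xs(1) by (auto simp: supported_on_def point_mass_def)
  have supp: "fun_space.comb ?ps c \<in> supported_on S" for c
    by (rule fun_space.comb_in_subspace [OF subspace_supported_on ps])
  have expand: "f = fun_space.comb ?ps (\<lambda>i. f (xs ! i))" if f: "f \<in> supported_on S" for f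
  proof
    fix y
    show "f y = fun_space.comb ?ps (\<lambda>i. f (xs ! i)) y"
    proof (cases "y \<in> S")
      case True
      then obtain i where "i < length xs" "y = xs ! i" using xs(1) by (metis in_set_conv_nth)
      then show ?thesis by (simp add: comb)
    next
      case False
      then show ?thesis using f supp [of "\<lambda>i. f (xs ! i)"] by (simp add: supported_on_def)
    qed
  qed
  have B: "fun_space.basis_mod (supported_on S) {0} ?ps"
    unfolding fun_space.basis_mod_def
  proof (intro conjI ballI allI impI ps)
    fix f assume "f \<in> supported_on S"
    from expand [OF this] show "\<exists>c. f - fun_space.comb ?ps c \<in> {0}"
      by (metis cancel_comm_monoid_add_class.diff_cancel singletonI)
  next
    fix c i assume "fun_space.comb ?ps c \<in> {0}" "i < length ?ps"
    then show "c i = 0" using comb [of i c] by simp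
  qed
  have "fun_space.coord_mod {0} ?ps (T (point_mass (xs ! i))) i = T (point_mass (xs ! i)) (xs ! i)"
    if i: "i < length xs" for i
  proof -
    let ?f = "T (point_mass (xs ! i))"
    have "?f \<in> supported_on S" using TS ps i by force
    from expand [OF this] have "?f - fun_space.comb ?ps (\<lambda>j. ?f (xs ! j)) \<in> {0}" by simp
    from fun_space.coord_mod_eq [OF fun_space.subspace_single_0 B this] i show ?thesis by simp
  qed
  then have "fun_space.trace_wrt {0} ?ps T = (\<Sum>i<length xs. T (point_mass (xs ! i)) (xs ! i))"
    by (simp add: fun_space.trace_wrt_def)
  also have "\<dots> = (\<Sum>x\<in>S. T (point_mass x) x)"
    using bij_betw_nth [OF xs(2) HOL.refl xs(1) [symmetric]]
    by (rule sum.reindex_bij_betw)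
  finally show ?thesis
    using fun_space.trace_mod_eq [OF fun_space.subspace_single_0 B T TS] by (simp add: T.zero)
qed

section \<open>The Lefschetz number of a graph automorphism\<close>

lemma finite_ordered_cliques:
  assumes "finite (verts K)"
  shows "finite (ordered_cliques K n)"
  by (rule finite_subset [OF _ finite_lists_length_eq [OF assms, of n]])
    (auto simp: ordered_cliques_def)

lemma ordered_cliques_empty:
  assumes "finite (verts K)" "card (verts K) < n"
  shows "ordered_cliques K n = {}"
proof -
  have "length xs \<le> card (verts K)" if "distinct xs" "set xs \<subseteq> verts K" for xs
    using that assms(1) by (metis card_mono distinct_card)
  then show ?thesis using assms(2) by (fastforce simp: ordered_cliques_def)
qed

section \<open>Cochains, cocycles and coboundaries as subspaces of a function space\<close>

lemma subspace_cochains: "fun_space.subspace (carrier (cochains K k))"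
  by (auto simp: fun_space.subspace_def carrier_cochains alternating_def fun_scale_def algebra_simps)

lemma cochains_supported: "carrier (cochains K k) \<subseteq> supported_on (ordered_cliques K (Suc k))"
  by (auto simp: carrier_cochains supported_on_def)

lemma module_hom_ext_deriv: "module_hom fun_scale fun_scale (ext_deriv K k)"
  by (rule module_hom_fun_scaleI)
    (auto simp: ext_deriv_eq fun_scale_def fun_eq_iff sum.distrib sum_distrib_left algebra_simps
      simp del: sum.atMost_Suc)

lemma module_hom_pullback: "module_hom fun_scale fun_scale (pullback K k T)"
  by (rule module_hom_fun_scaleI) (auto simp: pullback_def fun_scale_def fun_eq_iff)

lemma module_hom_antisymmetrize: "module_hom fun_scale fun_scale (antisymmetrize K k)"
  by (rule module_hom_fun_scaleI)
    (auto simp: antisymmetrize_def fun_scale_def fun_eq_iff sum.distrib sum_distrib_left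
      algebra_simps add_divide_distrib simp del: lessThan_Suc fact_Suc)

lemma cocycles_eq: "cocycles K k = {f \<in> carrier (cochains K k). ext_deriv K k f = 0}"
  by (auto simp: cocycles_def a_kernel_def kernel_def cochains_def zero_fun_def)

lemma cocycle_space_eq: "cocycle_space K k = fun_space.subspace_module (cocycles K k)"
  by (simp add: cocycle_space_def cochains_def fun_space.subspace_module_def zero_fun_def)
    (simp add: fun_eq_iff fun_scale_def)

lemma subspace_cocycles: "fun_space.subspace (cocycles K k)"
proof -
  interpret d: module_hom fun_scale fun_scale "ext_deriv K k" by (rule module_hom_ext_deriv)
  show ?thesis
    using subspace_cochains [of K k]
    by (auto simp: cocycles_eq fun_space.subspace_def d.add d.scale d.zero)
qed

lemma coboundaries_0: "coboundaries K 0 = {0}"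
  by (simp add: cochains_def zero_fun_def)

lemma subspace_coboundaries: "fun_space.subspace (coboundaries K k)"
proof (cases k)
  case 0
  then show ?thesis by (simp add: coboundaries_0 del: coboundaries.simps(1))
next
  case (Suc j)
  interpret d: module_hom fun_scale fun_scale "ext_deriv K j" by (rule module_hom_ext_deriv)
  show ?thesis using Suc d.subspace_image [OF subspace_cochains] by simp
qed

lemma coboundaries_subset_cocycles: "coboundaries K k \<subseteq> cocycles K k"
proof (cases k)
  case 0
  then show ?thesis
    using fun_space.subspace_0 [OF subspace_cocycles] by (simp add: coboundaries_0 del: coboundaries.simps(1))
next
  case (Suc j)
  then show ?thesis
    by (auto simp: cocycles_eq ext_deriv_cochain ext_deriv_ext_deriv zero_fun_def)
qed

text \<open>Coboundaries are cochains on lists of k + 1 distinct vertices, and there are no such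
  lists. This settles the upper end of the telescoping series.\<close>

lemma coboundaries_trivial:
  assumes "finite (verts K)" "card (verts K) < k"
  shows "coboundaries K k = {0}"
proof (cases k)
  case (Suc j)
  then have "carrier (cochains K k) \<subseteq> {0}"
    using ordered_cliques_empty [of K "Suc k"] assms by (auto simp: carrier_cochains fun_eq_iff)
  moreover have "coboundaries K k \<subseteq> carrier (cochains K k)"
    using coboundaries_subset_cocycles [of K k] by (auto simp: cocycles_eq)
  ultimately show ?thesis using fun_space.subspace_0 [OF subspace_coboundaries [of K k]] by blast
qed (use assms in simp)

context
  fixes K :: "'v graph" and T :: "'v \<Rightarrow> 'v"
  assumes finite: "finite (verts K)" and inj: "inj_on T (verts K)" and hom: "graph_hom K K T"
begin

lemma pullback_cochains_subset:
  "pullback K k T ` carrier (cochains K k) \<subseteq> carrier (cochains K k)"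
  using pullback_cochain [OF inj hom] by blast

lemma pullback_cocycles_subset: "pullback K k T ` cocycles K k \<subseteq> cocycles K k"
proof -
  interpret p: module_hom fun_scale fun_scale "pullback K (Suc k) T" by (rule module_hom_pullback)
  show ?thesis
    using pullback_cochain [OF inj hom] by (auto simp: cocycles_eq ext_deriv_pullback [OF inj hom] p.zero)
qed

lemma pullback_coboundaries_subset: "pullback K k T ` coboundaries K k \<subseteq> coboundaries K k"
proof (cases k)
  case 0
  interpret p: module_hom fun_scale fun_scale "pullback K k T" by (rule module_hom_pullback)
  show ?thesis using p.zero by (simp add: 0 coboundaries_0 del: coboundaries.simps(1))
next
  case (Suc j)
  then show ?thesis
    using pullback_cochain [OF inj hom] by (auto simp flip: ext_deriv_pullback [OF inj hom])
qed

lemma cochains_span: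
  "carrier (cochains K k) \<subseteq> fun_space.span (point_mass ` ordered_cliques K (Suc k))"
  using cochains_supported supported_on_span [OF finite_ordered_cliques [OF finite]] by blast

lemma cocycles_span: "cocycles K k \<subseteq> fun_space.span (point_mass ` ordered_cliques K (Suc k))"
  using cochains_span by (auto simp: cocycles_eq)

lemma trace_on_cohomology:
  "trace_on (cohomology K k) (cohomology_map K k T) =
     fun_space.trace_mod (cocycles K k) (coboundaries K k) (pullback K k T)"
  unfolding cohomology_def cohomology_map_def cocycle_space_eq
  by (rule fun_space.trace_on_quotient [OF subspace_coboundaries subspace_cocycles
        coboundaries_subset_cocycles _ cocycles_span module_hom_pullback
        pullback_cocycles_subset pullback_coboundaries_subset])
    (simp add: finite_ordered_cliques [OF finite])

lemma trace_cochains_decomposition: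
  "fun_space.trace_mod (carrier (cochains K k)) {0} (pullback K k T) =
     fun_space.trace_mod (coboundaries K k) {0} (pullback K k T) +
     trace_on (cohomology K k) (cohomology_map K k T) +
     fun_space.trace_mod (coboundaries K (Suc k)) {0} (pullback K (Suc k) T)"
proof -
  interpret p: module_hom fun_scale fun_scale "pullback K k T" by (rule module_hom_pullback)
  let ?C = "carrier (cochains K k)" and ?Z = "cocycles K k" and ?B = "coboundaries K k"
  let ?F = "point_mass ` ordered_cliques K (Suc k)"
  have F: "finite ?F" by (simp add: finite_ordered_cliques [OF finite])
  have null: "{0} \<subseteq> ?Z" "{0} \<subseteq> ?B" "pullback K k T ` {0} \<subseteq> {0}"
    using fun_space.subspace_0 [OF subspace_cocycles] fun_space.subspace_0 [OF subspace_coboundaries]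
    by (simp_all add: p.zero)
  have "?Z \<subseteq> ?C" by (auto simp: cocycles_eq)
  then have "fun_space.trace_mod ?C {0} (pullback K k T) =
      fun_space.trace_mod ?Z {0} (pullback K k T) + fun_space.trace_mod ?C ?Z (pullback K k T)"
    by (intro fun_space.trace_mod_add [OF fun_space.subspace_single_0 subspace_cocycles
          subspace_cochains null(1) _ F cochains_span module_hom_pullback
          pullback_cochains_subset pullback_cocycles_subset null(3)])
  also have "fun_space.trace_mod ?Z {0} (pullback K k T) =
      fun_space.trace_mod ?B {0} (pullback K k T) + fun_space.trace_mod ?Z ?B (pullback K k T)"
    by (intro fun_space.trace_mod_add [OF fun_space.subspace_single_0 subspace_coboundaries
          subspace_cocycles null(2) coboundaries_subset_cocycles F cocycles_span
          module_hom_pullback pullback_cocycles_subset pullback_coboundaries_subset null(3)])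
  \<comment> \<open>The derivative raises the degree, so the pullback of degree k + 1 acts on its
    image. This shift of the index makes the terms telescope.\<close>
  also have "fun_space.trace_mod ?C ?Z (pullback K k T) =
      fun_space.trace_mod (coboundaries K (Suc k)) {0} (pullback K (Suc k) T)"
    unfolding cocycles_eq coboundaries.simps
    by (rule fun_space.trace_mod_kernel [where T' = "pullback K (Suc k) T", OF subspace_cochains F
          cochains_span module_hom_ext_deriv module_hom_pullback pullback_cochains_subset
          module_hom_pullback]) (rule ext_deriv_pullback [OF inj hom])
  finally show ?thesis by (simp only: trace_on_cohomology)
qed

text \<open>Composing with the projection onto the alternating functions turns the trace into a sum
  over ordered cliques, and each diagonal entry involves a permutation that maps \<open>T\<close> of a clique
  back to that clique.\<close>

lemma trace_cochains_eq_0: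
  assumes no_fixed: "\<And>xs. xs \<in> ordered_cliques K (Suc k) \<Longrightarrow> T ` set xs \<noteq> set xs"
  shows "fun_space.trace_mod (carrier (cochains K k)) {0} (pullback K k T) = 0"
proof -
  let ?C = "carrier (cochains K k)" and ?O = "ordered_cliques K (Suc k)"
  let ?Q = "\<lambda>f. pullback K k T (antisymmetrize K k f)"
  interpret p: module_hom fun_scale fun_scale "pullback K k T" by (rule module_hom_pullback)
  have finO: "finite ?O" by (rule finite_ordered_cliques [OF finite])
  then have F: "finite (point_mass ` ?O)" by simp
  have Q: "module_hom fun_scale fun_scale ?Q"
    using module_hom_compose [OF module_hom_antisymmetrize module_hom_pullback] by (simp add: o_def)
  have QC: "?Q f \<in> ?C" for f
    by (rule pullback_cochain [OF inj hom antisymmetrize_cochain])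
  have 0: "0 \<in> ?C" by (rule fun_space.subspace_0 [OF subspace_cochains])
  obtain rs where rs: "fun_space.basis_mod ?C {0} rs"
    using fun_space.basis_mod_exists [OF fun_space.subspace_single_0 subspace_cochains _ F cochains_span]
      0 by blast
  have "fun_space.trace_mod ?C {0} (pullback K k T) = fun_space.trace_mod ?C {0} ?Q"
    by (rule fun_space.trace_mod_cong [OF fun_space.subspace_single_0 rs module_hom_pullback
          pullback_cochains_subset _ Q])
      (use 0 in \<open>auto simp: p.zero antisymmetrize_id\<close>)
  \<comment> \<open>All values of \<open>?Q\<close> are cochains, so passing to the larger space of
    all functions on ordered cliques adds nothing to the trace.\<close>
  also have "\<dots> = fun_space.trace_mod (supported_on ?O) {0} ?Q"
    by (rule fun_space.trace_mod_range [symmetric, OF subspace_cochains subspace_supported_on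
          cochains_supported F supported_on_span [OF finO] Q]) (use QC in blast)
  also have "\<dots> = (\<Sum>xs\<in>?O. ?Q (point_mass xs) xs)"
    by (rule trace_mod_supported_on [OF finO Q]) (use QC cochains_supported in blast)
  also have "\<dots> = 0"
  proof (rule sum.neutral, rule ballI)
    fix xs assume xs: "xs \<in> ?O"
    have "point_mass xs (permute_list p (map T xs)) = 0" if "p permutes {..<Suc k}" for p
    proof -
      have "p permutes {..<length (map T xs)}" using xs that by (simp add: ordered_cliques_def)
      then have "set (permute_list p (map T xs)) = T ` set xs" by simp
      then have "permute_list p (map T xs) \<noteq> xs" using no_fixed [OF xs] by metis
      then show ?thesis by (simp add: point_mass_def)
    qed
    then show "?Q (point_mass xs) xs = 0"
      using xs by (simp add: pullback_def antisymmetrize_def del: lessThan_Suc)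
  qed
  finally show ?thesis .
qed

theorem lefschetz_fixed_clique:
  assumes "lefschetz_number K T \<noteq> 0"
  shows "\<exists>k. \<exists>xs\<in>ordered_cliques K (Suc k). T ` set xs = set xs"
proof (rule ccontr)
  assume no_fixed: "\<not> ?thesis"
  \<comment> \<open>The sign is chosen so that the term of degree k in the Lefschetz number becomes
    \<open>b (Suc k) - b k\<close>.\<close>
  define b where "b k = (-1) ^ k * fun_space.trace_mod (coboundaries K k) {0} (pullback K k T)" for k
  have null: "fun_space.trace_mod {0} {0} (pullback K k T) = 0" for k
    by (rule fun_space.trace_mod_null [OF module_hom_pullback])
  have "(-1) ^ k * trace_on (cohomology K k) (cohomology_map K k T) = b (Suc k) - b k" for k
  proof -
    have "fun_space.trace_mod (carrier (cochains K k)) {0} (pullback K k T) = 0"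
      using trace_cochains_eq_0 no_fixed by blast
    then have "trace_on (cohomology K k) (cohomology_map K k T) =
        - fun_space.trace_mod (coboundaries K (Suc k)) {0} (pullback K (Suc k) T) -
        fun_space.trace_mod (coboundaries K k) {0} (pullback K k T)"
      using trace_cochains_decomposition [of k] by linarith
    then show ?thesis
      by (simp only: b_def power_Suc) (simp add: algebra_simps del: coboundaries.simps)
  qed
  moreover have "b \<longlonglongrightarrow> 0"
  proof (rule tendsto_eventually)
    have "b k = 0" if "card (verts K) < k" for k
      using coboundaries_trivial [OF finite that] null by (simp add: b_def)
    then show "\<forall>\<^sub>F k in sequentially. b k = 0"
      unfolding eventually_sequentially by (intro exI [of _ "Suc (card (verts K))"]) auto
  qed
  from telescope_sums [OF this] have "(\<lambda>k. b (Suc k) - b k) sums - b 0" by simp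
  moreover have "b 0 = 0" using null by (simp add: b_def coboundaries_0 del: coboundaries.simps)
  ultimately have "lefschetz_number K T = 0"
    by (simp add: lefschetz_number_def sums_iff)
  then show False using assms by contradiction
qed

end

section \<open>Contractible graphs\<close>

text \<open>The two predicates are defined together, so both facts need one induction. An extension
  attaches the new vertex to a contractible, hence nonempty, subgraph; a reduction leaves the
  nonempty sphere of the removed vertex. Simplicity is carried along because it excludes a loop,
  which would put the vertex into its own sphere.\<close>

lemma
  contractible_nat_nonempty: "contractible_nat G \<Longrightarrow> verts G \<noteq> {}" and
  homotopic_nat_invariant: "homotopic_nat G H \<Longrightarrow>
    simple_graph H \<and> (verts G = {} \<longleftrightarrow> verts H = {})"
proof (induction rule: contractible_nat_homotopic_nat.inducts)
  case (extend G H S z)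
  have "{z, y} \<subseteq> insert z (verts H) \<and> card {z, y} = 2" if "y \<in> S" for y
    using extend that by (auto simp: card_insert_if)
  moreover have "verts H \<noteq> {}" using extend by (auto simp: induced_subgraph_def)
  ultimately show ?case
    using extend by (auto simp: add_vertex_def simple_graph_def)
next
  case (reduce G H z)
  have "{z, z} \<notin> edges H" using reduce by (force simp: simple_graph_def)
  then have "z \<notin> verts (sphere H z)" by (simp add: sphere_def induced_subgraph_def)
  moreover have "verts (sphere H z) \<subseteq> verts H" by (auto simp: sphere_def induced_subgraph_def)
  ultimately have "verts H - {z} \<noteq> {}" using reduce by blast
  then show ?case
    using reduce by (auto simp: remove_vertex_def induced_subgraph_def simple_graph_def)
qed auto

lemma contractible_graph_nonempty: "contractible_graph A \<Longrightarrow> verts A \<noteq> {}"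
  using contractible_nat_nonempty
  by (fastforce simp: contractible_graph_def graph_isomorphic_def bij_betw_def)

theorem theorem8:
  fixes G :: "'a graph" and \<B> :: "'a graph set" and X :: "'a topology"
    and \<phi> :: "'a set \<Rightarrow> 'a set" and T :: "'a graph \<Rightarrow> 'a graph"
  assumes "topological_graph G \<B> X"
    and "graph_homeomorphism \<B> X \<B> X \<phi> T"
    and "lefschetz_number (nerve \<B>) T \<noteq> 0"
  shows "\<exists>S. S \<noteq> {} \<and> S \<subseteq> \<B> \<and>
           (\<forall>A\<in>S. \<forall>B\<in>S. verts (graph_inter A B) \<noteq> {}) \<and>
           graph_Union (T ` S) = graph_Union S"
proof -
  have G: "simple_graph G" and sub: "\<And>A. A \<in> \<B> \<Longrightarrow> is_subgraph A G"
    and contr: "\<And>A. A \<in> \<B> \<Longrightarrow> contractible_graph A"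
    and inter: "\<And>A B. A \<in> \<B> \<Longrightarrow> B \<in> \<B> \<Longrightarrow> dimension_assumption A B \<Longrightarrow>
      contractible_graph (graph_inter A B)"
    using assms(1) unfolding topological_graph_def by blast+
  \<comment> \<open>Members of the sub-base need not be induced subgraphs, so they are counted by
    pairs of a vertex set and an edge set. This makes the nerve finite.\<close>
  have "\<B> \<subseteq> (\<lambda>(V, E). Graph V E) ` (Pow (verts G) \<times> Pow (edges G))"
  proof
    fix A assume "A \<in> \<B>"
    then have "A = Graph (verts A) (edges A)" "verts A \<subseteq> verts G" "edges A \<subseteq> edges G"
      using sub by (auto simp: is_subgraph_def)
    then show "A \<in> (\<lambda>(V, E). Graph V E) ` (Pow (verts G) \<times> Pow (edges G))"
      by (intro image_eqI [of _ _ "(verts A, edges A)"]) auto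
  qed
  moreover have "finite (verts G)" "finite (edges G)"
    using G finite_subset [of "edges G" "Pow (verts G)"] by (auto simp: simple_graph_def)
  ultimately have fin: "finite (verts (nerve \<B>))"
    by (simp add: nerve_def finite_subset)
  have hom: "graph_hom (nerve \<B>) (nerve \<B>) T"
    using assms(2) by (simp add: graph_homeomorphism_def graph_continuous_def)
  obtain \<sigma> where "\<forall>A\<in>\<B>. \<sigma> (T A) = A"
    using assms(2) unfolding graph_homeomorphism_def by blast
  then have inj: "inj_on T (verts (nerve \<B>))"
    by (intro inj_on_inverseI [of _ \<sigma>]) (simp add: nerve_def)
  obtain k xs where xs: "xs \<in> ordered_cliques (nerve \<B>) (Suc k)" and fixed: "T ` set xs = set xs"
    using lefschetz_fixed_clique [OF fin inj hom assms(3)] by blast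
  have subset: "set xs \<subseteq> \<B>" using xs by (simp add: ordered_cliques_def nerve_def)
  have "verts (graph_inter A B) \<noteq> {}" if AB: "A \<in> set xs" "B \<in> set xs" for A B
  proof (cases "A = B")
    case True
    then show ?thesis
      using contractible_graph_nonempty contr subset AB by (auto simp: graph_inter_def)
  next
    case False
    have "{A, B} \<in> edges (nerve \<B>)" using xs AB False by (auto simp: ordered_cliques_def)
    \<comment> \<open>An edge of the nerve is an unordered pair, so the condition is known in one of
      the two orders; the common vertices are the same in both.\<close>
    then have "dimension_assumption A B \<or> dimension_assumption B A"
      by (auto simp: nerve_def doubleton_eq_iff)
    then have "verts (graph_inter A B) \<noteq> {} \<or> verts (graph_inter B A) \<noteq> {}"
      using contractible_graph_nonempty inter subset AB by blast
    then show ?thesis by (simp add: graph_inter_def Int_commute)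
  qed
  moreover have "set xs \<noteq> {}" using xs by (auto simp: ordered_cliques_def)
  ultimately show ?thesis using subset fixed by (intro exI [of _ "set xs"]) auto
qed

end
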